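(* Let $G$ be a finite group and $T$ a $G$-Tambara functor. Let $\mathrm{RadId}_G(T)$ be the frame of radical Tambara ideals of $T$ (ordered by inclusion). Then there is a canonical homeomorphism \[ \mathrm{pt}\bigl(\mathrm{RadId}_G(T)\bigr)\cong \operatorname{Spec}_{\mathbf{Nak}}(T) \] under which, for each $I\in \mathrm{RadId}_G(T)$, the basic open $U(I)=\{p\mid p(I)=1\}$ corresponds to $\{P\in \operatorname{Spec}_{\mathbf{Nak}}(T)\mid I\not\subseteq P\}$.
   Context: All rings are commutative with unit. A $G$-Tambara functor $T$ consists of commutative rings $T(G/H)$ for each subgroup $H\le G$, ring homomorphisms (restrictions) $r^H_K\colon T(G/H)\to T(G/K)$, additive maps (transfers) $t^H_K\colon T(G/K)\to T(G/H)$ and multiplicative maps (norms) $N^H_K\colon T(G/K)\to T(G/H)$ for $K\le H$, and ring isomorphisms (conjugations) $c_{g,H}\colon T(G/H)\to T(G/gHg^{-1})$, satisfying the standard axioms (functoriality, conjugation compatibility, additive and multiplicative double coset formulas, Frobenius reciprocity, Tambara reciprocity), as in Hill–Mazur. A (Tambara) ideal $I\trianglelefteq T$ is a family of ring ideals $I(G/H)\subseteq T(G/H)$ with $r^H_K(I(G/H))\subseteq I(G/K)$, $t^H_K(I(G/K))\subseteq I(G/H)$, $N^H_K(I(G/K))\subseteq I(G/H)$ for all $K\le H$, and $c_{g,H}(I(G/H))=I(G/gHg^{-1})$; it is proper if $1\notin I(G/G)$. Intersections and levelwise sums of Tambara ideals are Tambara ideals; $\langle X\rangle$ denotes the smallest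 Tambara ideal containing a given set $X$ of elements (each at a specified level), and $\langle x\rangle$ for $x\in T(G/H)$ the one generated by $x$. The product $IJ$ of Tambara ideals is the Tambara ideal generated by the levelwise products $I(G/H)\cdot J(G/H)$, $H\le G$. The radical $\sqrt{I}$ is the Tambara ideal with $\sqrt{I}(G/H)=\{x\in T(G/H)\mid \langle x\rangle^n\subseteq I \text{ for some } n\ge 1\}$; $I$ is radical if $I=\sqrt I$. A proper ideal $P$ is prime if for all Tambara ideals $I,J$, $IJ\subseteq P$ implies $I\subseteq P$ or $J\subseteq P$. $\operatorname{Spec}_{\mathbf{Nak}}(T)$ is the set of prime Tambara ideals, topologized by taking the sets $V_H(x)=\{P\mid x\in P(G/H)\}$ ($H\le G$, $x\in T(G/H)$) as a subbasis of closed sets. $\mathrm{RadId}_G(T)$ is the set of radical Tambara ideals ordered by inclusion; it is a frame (complete lattice in which finite meets distribute over arbitrary joins), with meets intersections and joins $\bigvee_\lambda I_\lambda=\sqrt{\sum_\lambda I_\lambda}$. For a frame $A$, a point is a map $p\colon A\to\{0<1\}$ preserving arbitrary joins and finite meets (including the top element); $\mathrm{pt}(A)$ is the set of points with the topology whose basic opens are $U(a)=\{p\mid p(a)=1\}$, $a\in A$. *)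

theory Defs
  imports "HOL-Analysis.Analysis" "HOL-Algebra.Ideal" "HOL-Algebra.RingHom" "HOL-Algebra.Coset" "HOL-Algebra.QuotRing"
begin

text \<open>Data of a G-Tambara functor: levels T(G/H) (indexed by the subgroup H), restriction
 res H K : T(G/H) -> T(G/K), transfer tr H K : T(G/K) -> T(G/H), norm nm H K : T(G/K) -> T(G/H)
 (all for K <= H), and conjugation cj g H : T(G/H) -> T(G/gHg^-1).\<close>

record ('g, 'a) tambara_data =
  lev :: "'g set \<Rightarrow> 'a ring"
  res :: "'g set \<Rightarrow> 'g set \<Rightarrow> 'a \<Rightarrow> 'a"
  tr  :: "'g set \<Rightarrow> 'g set \<Rightarrow> 'a \<Rightarrow> 'a"
  nm  :: "'g set \<Rightarrow> 'g set \<Rightarrow> 'a \<Rightarrow> 'a"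
  cj  :: "'g \<Rightarrow> 'g set \<Rightarrow> 'a \<Rightarrow> 'a"

definition conjset :: "('g, 'b) monoid_scheme \<Rightarrow> 'g \<Rightarrow> 'g set \<Rightarrow> 'g set" where
  "conjset G g H = (\<lambda>h. g \<otimes>\<^bsub>G\<^esub> h \<otimes>\<^bsub>G\<^esub> inv\<^bsub>G\<^esub> g) ` H"

definition subgrp_le :: "('g, 'b) monoid_scheme \<Rightarrow> 'g set \<Rightarrow> 'g set \<Rightarrow> bool" where
  "subgrp_le G K H \<longleftrightarrow> subgroup K G \<and> subgroup H G \<and> K \<subseteq> H"

definition dcosets :: "('g, 'b) monoid_scheme \<Rightarrow> 'g set \<Rightarrow> 'g set \<Rightarrow> 'g set \<Rightarrow> 'g set set" where
  "dcosets G H L K = {L <#>\<^bsub>G\<^esub> (g <#\<^bsub>G\<^esub> K) | g. g \<in> H}"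

definition dc_rep :: "('g, 'b) monoid_scheme \<Rightarrow> 'g set \<Rightarrow> 'g set \<Rightarrow> 'g set \<Rightarrow> 'g set \<Rightarrow> 'g" where
  "dc_rep G H L K d = (SOME g. g \<in> H \<and> d = L <#>\<^bsub>G\<^esub> (g <#\<^bsub>G\<^esub> K))"

definition cosets_in :: "('g, 'b) monoid_scheme \<Rightarrow> 'g set \<Rightarrow> 'g set \<Rightarrow> 'g set set" where
  "cosets_in G H K = {h <#\<^bsub>G\<^esub> K | h. h \<in> H}"

definition act_subset :: "('g, 'b) monoid_scheme \<Rightarrow> 'g \<Rightarrow> 'g set set \<Rightarrow> 'g set set" where
  "act_subset G h A = (\<lambda>C. h <#\<^bsub>G\<^esub> C) ` A"

definition subset_orbits :: "('g, 'b) monoid_scheme \<Rightarrow> 'g set \<Rightarrow> 'g set \<Rightarrow> 'g set set set set" where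
  "subset_orbits G H K = {(\<lambda>h. act_subset G h A) ` H | A. A \<subseteq> cosets_in G H K}"

definition stab :: "('g, 'b) monoid_scheme \<Rightarrow> 'g set \<Rightarrow> 'g set set \<Rightarrow> 'g set" where
  "stab G H A = {h \<in> H. act_subset G h A = A}"

definition point_orbits :: "('g, 'b) monoid_scheme \<Rightarrow> 'g set \<Rightarrow> 'g set \<Rightarrow> 'g set \<Rightarrow> 'g set set set" where
  "point_orbits G H L K = {(\<lambda>l. l <#\<^bsub>G\<^esub> C) ` L | C. C \<in> cosets_in G H K}"

text \<open>Right-hand side of Tambara reciprocity for N^H_K(a + b): a sum over H-orbits of
 functions f : H/K -> {a,b} (encoded by the subset A = f^-1(b)), each term being
 tr^H_{L} of the product over L-orbits of H/K (L = stabiliser of f) of the norms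
 N^L_{L \<inter> hKh^-1} r^{hKh^-1}_{L \<inter> hKh^-1} c_h (f(hK)).\<close>
definition tambara_recip_rhs ::
  "('g, 'b) monoid_scheme \<Rightarrow> ('g, 'a, 'c) tambara_data_scheme \<Rightarrow> 'g set \<Rightarrow> 'g set \<Rightarrow> 'a \<Rightarrow> 'a \<Rightarrow> 'a" where
  "tambara_recip_rhs G T H K a b =
     finsum (lev T H)
       (\<lambda>\<Omega>. let A = (SOME A. A \<in> \<Omega>); L = stab G H A in
          tr T H L
            (finprod (lev T L)
               (\<lambda>Orb. let h = (SOME h. h \<in> H \<and> h <#\<^bsub>G\<^esub> K \<in> Orb); K' = conjset G h K in
                  nm T L (L \<inter> K') (res T K' (L \<inter> K')
                     (cj T h K (if h <#\<^bsub>G\<^esub> K \<in> A then b else a))))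
               (point_orbits G H L K)))
       (subset_orbits G H K)"

definition tambara_functor :: "('g, 'b) monoid_scheme \<Rightarrow> ('g, 'a, 'c) tambara_data_scheme \<Rightarrow> bool" where
  "tambara_functor G T \<longleftrightarrow>
     \<comment> \<open>levels are commutative rings\<close>
     (\<forall>H. subgroup H G \<longrightarrow> cring (lev T H)) \<and>
     \<comment> \<open>restrictions are ring homomorphisms, transfers additive, norms multiplicative\<close>
     (\<forall>H K. subgrp_le G K H \<longrightarrow>
        res T H K \<in> ring_hom (lev T H) (lev T K) \<and>
        tr T H K \<in> carrier (lev T K) \<rightarrow> carrier (lev T H) \<and>
        (\<forall>x\<in>carrier (lev T K). \<forall>y\<in>carrier (lev T K).
            tr T H K (x \<oplus>\<^bsub>lev T K\<^esub> y) = tr T H K x \<oplus>\<^bsub>lev T H\<^esub> tr T H K y) \<and>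
        nm T H K \<in> carrier (lev T K) \<rightarrow> carrier (lev T H) \<and>
        (\<forall>x\<in>carrier (lev T K). \<forall>y\<in>carrier (lev T K).
            nm T H K (x \<otimes>\<^bsub>lev T K\<^esub> y) = nm T H K x \<otimes>\<^bsub>lev T H\<^esub> nm T H K y) \<and>
        nm T H K \<one>\<^bsub>lev T K\<^esub> = \<one>\<^bsub>lev T H\<^esub>) \<and>
     \<comment> \<open>functoriality\<close>
     (\<forall>H. subgroup H G \<longrightarrow> (\<forall>x\<in>carrier (lev T H).
        res T H H x = x \<and> tr T H H x = x \<and> nm T H H x = x)) \<and>
     (\<forall>H K L. subgrp_le G L K \<and> subgrp_le G K H \<longrightarrow>
        (\<forall>x\<in>carrier (lev T H). res T K L (res T H K x) = res T H L x) \<and>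
        (\<forall>x\<in>carrier (lev T L). tr T H K (tr T K L x) = tr T H L x \<and>
                                  nm T H K (nm T K L x) = nm T H L x)) \<and>
     \<comment> \<open>conjugations: ring isomorphisms, functorial, inner ones trivial\<close>
     (\<forall>g\<in>carrier G. \<forall>H. subgroup H G \<longrightarrow>
        cj T g H \<in> ring_iso (lev T H) (lev T (conjset G g H))) \<and>
     (\<forall>g\<in>carrier G. \<forall>h\<in>carrier G. \<forall>H. subgroup H G \<longrightarrow> (\<forall>x\<in>carrier (lev T H).
        cj T h (conjset G g H) (cj T g H x) = cj T (h \<otimes>\<^bsub>G\<^esub> g) H x)) \<and>
     (\<forall>H. subgroup H G \<longrightarrow> (\<forall>h\<in>H. \<forall>x\<in>carrier (lev T H). cj T h H x = x)) \<and>
     \<comment> \<open>compatibility of conjugation with restriction, transfer and norm\<close>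
     (\<forall>g\<in>carrier G. \<forall>H K. subgrp_le G K H \<longrightarrow>
        (\<forall>x\<in>carrier (lev T H).
           cj T g K (res T H K x) = res T (conjset G g H) (conjset G g K) (cj T g H x)) \<and>
        (\<forall>x\<in>carrier (lev T K).
           cj T g H (tr T H K x) = tr T (conjset G g H) (conjset G g K) (cj T g K x) \<and>
           cj T g H (nm T H K x) = nm T (conjset G g H) (conjset G g K) (cj T g K x))) \<and>
     \<comment> \<open>additive and multiplicative double coset formulas\<close>
     (\<forall>H K L. subgrp_le G K H \<and> subgrp_le G L H \<longrightarrow> (\<forall>x\<in>carrier (lev T K).
        res T H L (tr T H K x) =
          finsum (lev T L) (\<lambda>d. let g = dc_rep G H L K d; K' = conjset G g K in
              tr T L (L \<inter> K') (res T K' (L \<inter> K') (cj T g K x))) (dcosets G H L K) \<and>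
        res T H L (nm T H K x) =
          finprod (lev T L) (\<lambda>d. let g = dc_rep G H L K d; K' = conjset G g K in
              nm T L (L \<inter> K') (res T K' (L \<inter> K') (cj T g K x))) (dcosets G H L K))) \<and>
     \<comment> \<open>Frobenius reciprocity\<close>
     (\<forall>H K. subgrp_le G K H \<longrightarrow> (\<forall>a\<in>carrier (lev T K). \<forall>b\<in>carrier (lev T H).
        tr T H K (a \<otimes>\<^bsub>lev T K\<^esub> res T H K b) = tr T H K a \<otimes>\<^bsub>lev T H\<^esub> b)) \<and>
     \<comment> \<open>Tambara reciprocity\<close>
     (\<forall>H K. subgrp_le G K H \<longrightarrow> (\<forall>a\<in>carrier (lev T K). \<forall>b\<in>carrier (lev T K).
        nm T H K (a \<oplus>\<^bsub>lev T K\<^esub> b) = tambara_recip_rhs G T H K a b))"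

text \<open>A family of subsets indexed by subgroups (empty at non-subgroups).\<close>
type_synonym ('g, 'a) fam = "'g set \<Rightarrow> 'a set"

definition tambara_ideal :: "('g, 'b) monoid_scheme \<Rightarrow> ('g, 'a, 'c) tambara_data_scheme \<Rightarrow> ('g, 'a) fam \<Rightarrow> bool" where
  "tambara_ideal G T I \<longleftrightarrow>
     (\<forall>H. \<not> subgroup H G \<longrightarrow> I H = {}) \<and>
     (\<forall>H. subgroup H G \<longrightarrow> ideal (I H) (lev T H)) \<and>
     (\<forall>H K. subgrp_le G K H \<longrightarrow>
        res T H K ` I H \<subseteq> I K \<and> tr T H K ` I K \<subseteq> I H \<and> nm T H K ` I K \<subseteq> I H) \<and>
     (\<forall>g\<in>carrier G. \<forall>H. subgroup H G \<longrightarrow> cj T g H ` I H = I (conjset G g H))"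

definition proper_ideal :: "('g, 'b) monoid_scheme \<Rightarrow> ('g, 'a, 'c) tambara_data_scheme \<Rightarrow> ('g, 'a) fam \<Rightarrow> bool" where
  "proper_ideal G T I \<longleftrightarrow> \<one>\<^bsub>lev T (carrier G)\<^esub> \<notin> I (carrier G)"

definition unit_ideal :: "('g, 'b) monoid_scheme \<Rightarrow> ('g, 'a, 'c) tambara_data_scheme \<Rightarrow> ('g, 'a) fam" where
  "unit_ideal G T = (\<lambda>H. if subgroup H G then carrier (lev T H) else {})"

definition gen_ideal :: "('g, 'b) monoid_scheme \<Rightarrow> ('g, 'a, 'c) tambara_data_scheme \<Rightarrow> ('g set \<times> 'a) set \<Rightarrow> ('g, 'a) fam" where
  "gen_ideal G T X = (\<lambda>H. \<Inter>{I H | I. tambara_ideal G T I \<and> (\<forall>(K, x)\<in>X. x \<in> I K)})"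

definition ideal_prod :: "('g, 'b) monoid_scheme \<Rightarrow> ('g, 'a, 'c) tambara_data_scheme \<Rightarrow> ('g, 'a) fam \<Rightarrow> ('g, 'a) fam \<Rightarrow> ('g, 'a) fam" where
  "ideal_prod G T I J = gen_ideal G T {(H, x \<otimes>\<^bsub>lev T H\<^esub> y) | H x y. subgroup H G \<and> x \<in> I H \<and> y \<in> J H}"

fun ideal_pow :: "('g, 'b) monoid_scheme \<Rightarrow> ('g, 'a, 'c) tambara_data_scheme \<Rightarrow> ('g, 'a) fam \<Rightarrow> nat \<Rightarrow> ('g, 'a) fam" where
  "ideal_pow G T I 0 = unit_ideal G T"
| "ideal_pow G T I (Suc n) = (if n = 0 then I else ideal_prod G T (ideal_pow G T I n) I)"

definition radical :: "('g, 'b) monoid_scheme \<Rightarrow> ('g, 'a, 'c) tambara_data_scheme \<Rightarrow> ('g, 'a) fam \<Rightarrow> ('g, 'a) fam" where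
  "radical G T I = (\<lambda>H. if subgroup H G then
      {x \<in> carrier (lev T H). \<exists>n\<ge>1. ideal_pow G T (gen_ideal G T {(H, x)}) n \<le> I} else {})"

definition RadId :: "('g, 'b) monoid_scheme \<Rightarrow> ('g, 'a, 'c) tambara_data_scheme \<Rightarrow> ('g, 'a) fam set" where
  "RadId G T = {I. tambara_ideal G T I \<and> radical G T I = I}"

definition prime_tideal :: "('g, 'b) monoid_scheme \<Rightarrow> ('g, 'a, 'c) tambara_data_scheme \<Rightarrow> ('g, 'a) fam \<Rightarrow> bool" where
  "prime_tideal G T P \<longleftrightarrow> tambara_ideal G T P \<and> proper_ideal G T P \<and>
     (\<forall>I J. tambara_ideal G T I \<and> tambara_ideal G T J \<and> ideal_prod G T I J \<le> P \<longrightarrow> I \<le> P \<or> J \<le> P)"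

definition SpecNak :: "('g, 'b) monoid_scheme \<Rightarrow> ('g, 'a, 'c) tambara_data_scheme \<Rightarrow> ('g, 'a) fam set" where
  "SpecNak G T = {P. prime_tideal G T P}"

text \<open>Topology on Spec: the sets V_H(x) form a subbasis of closed sets, i.e. their
 complements (together with the whole space, the empty intersection) a subbasis of opens.\<close>
definition V_set :: "('g, 'b) monoid_scheme \<Rightarrow> ('g, 'a, 'c) tambara_data_scheme \<Rightarrow> 'g set \<Rightarrow> 'a \<Rightarrow> ('g, 'a) fam set" where
  "V_set G T H x = {P \<in> SpecNak G T. x \<in> P H}"

definition spec_topology :: "('g, 'b) monoid_scheme \<Rightarrow> ('g, 'a, 'c) tambara_data_scheme \<Rightarrow> ('g, 'a) fam topology" where
  "spec_topology G T = topology_generated_by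
     (insert (SpecNak G T)
        {SpecNak G T - V_set G T H x | H x. subgroup H G \<and> x \<in> carrier (lev T H)})"

definition ideal_sum :: "('g, 'b) monoid_scheme \<Rightarrow> ('g, 'a, 'c) tambara_data_scheme \<Rightarrow> ('g, 'a) fam set \<Rightarrow> ('g, 'a) fam" where
  "ideal_sum G T F = (\<lambda>H. if subgroup H G then genideal (lev T H) (\<Union>I\<in>F. I H) else {})"

definition frame_join :: "('g, 'b) monoid_scheme \<Rightarrow> ('g, 'a, 'c) tambara_data_scheme \<Rightarrow> ('g, 'a) fam set \<Rightarrow> ('g, 'a) fam" where
  "frame_join G T F = radical G T (ideal_sum G T F)"

text \<open>A point of the frame RadId: a map to {0<1} (encoded as bool, and False outside RadId)
 preserving arbitrary joins and finite meets (including the top element).\<close>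
definition frame_points :: "('g, 'b) monoid_scheme \<Rightarrow> ('g, 'a, 'c) tambara_data_scheme \<Rightarrow> (('g, 'a) fam \<Rightarrow> bool) set" where
  "frame_points G T = {p.
     (\<forall>I. I \<notin> RadId G T \<longrightarrow> \<not> p I) \<and>
     p (unit_ideal G T) \<and>
     (\<forall>I\<in>RadId G T. \<forall>J\<in>RadId G T. p (inf I J) \<longleftrightarrow> p I \<and> p J) \<and>
     (\<forall>F. F \<subseteq> RadId G T \<longrightarrow> (p (frame_join G T F) \<longleftrightarrow> (\<exists>I\<in>F. p I)))}"

definition U_open :: "('g, 'b) monoid_scheme \<Rightarrow> ('g, 'a, 'c) tambara_data_scheme \<Rightarrow> ('g, 'a) fam \<Rightarrow> (('g, 'a) fam \<Rightarrow> bool) set" where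
  "U_open G T I = {p \<in> frame_points G T. p I}"

definition pt_topology :: "('g, 'b) monoid_scheme \<Rightarrow> ('g, 'a, 'c) tambara_data_scheme \<Rightarrow> (('g, 'a) fam \<Rightarrow> bool) topology" where
  "pt_topology G T = topology_generated_by
     (insert (frame_points G T) {U_open G T I | I. I \<in> RadId G T})"

end

theory Submission
  imports Defs
begin

text \<open>The radical of a Tambara ideal I is computed levelwise: x lies in it as soon as some power of x
  lies in I. Write J for the Tambara ideal generated by x. By induction on the subgroup L, the ring ideal
  J(L) is nilpotent modulo I(L), being generated by finitely many restricted conjugates of x and by the
  transfers and norms from the proper subgroups of L; a second induction converts this into nilpotence
  for the product of Tambara ideals. So radicals are radical ideals, and by Tambara reciprocity so
  are the frame joins. Each point p is then determined by the largest radical ideal P with p(P) = 0,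
  and multiplicativity of p on meets says exactly that P is prime.\<close>

text \<open>The definition by powers of <x> does not display closure of the radical under addition,
  which is why a levelwise description is sought. The obstacle is that every power J^n is generated
  anew as a Tambara ideal: its level at L also holds transfers and norms, so it may exceed the n-th
  power of the ring ideal J(L), and nilpotence of x does not pass to <x> in one step. What makes an
  induction possible is that the double coset formulas let smaller subgroups contribute to level L
  only through transfers and norms, while all other generators arrive through ring homomorphisms.
  Finiteness of G leaves finitely many conjugates and subgroups, so exponents can be added and one
  exponent can serve all levels. A second obstacle is that norms are not additive. Sums of ideals
  need the full reciprocity formula, and N(0) = 0 is not among the axioms: it has to be derived
  before the zero family, which is the empty sum, is known to be an ideal.\<close>

section \<open>Nilpotence modulo an ideal of a ring\<close>

text \<open>Nilpotence of a set \<open>S\<close> modulo an ideal \<open>Z\<close> is expressed as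
  \<open>factor_products R S n \<subseteq> Z\<close>. Products of elements, as opposed to powers of
  ideals, let one notion serve generators, images of transfers and norms, and whole ideals.\<close>

primrec factor_products :: "('a, 'b) ring_scheme \<Rightarrow> 'a set \<Rightarrow> nat \<Rightarrow> 'a set" where
  "factor_products R S 0 = {\<one>\<^bsub>R\<^esub>}"
| "factor_products R S (Suc n) = {a \<otimes>\<^bsub>R\<^esub> b | a b. a \<in> factor_products R S n \<and> b \<in> S}"

lemma factor_products_mono: "S \<subseteq> S' \<Longrightarrow> factor_products R S n \<subseteq> factor_products R S' n"
  by (induction n) auto

context cring
begin

lemma factor_products_closed: "S \<subseteq> carrier R \<Longrightarrow> factor_products R S n \<subseteq> carrier R"
  by (induction n) auto

lemma factor_products_singleton: "x \<in> carrier R \<Longrightarrow> factor_products R {x} n = {x [^] n}"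
  by (induction n) auto

lemma factor_products_one: "S \<subseteq> carrier R \<Longrightarrow> factor_products R S (Suc 0) = S"
  by (auto simp: subset_iff) (metis l_one)

lemma pow_in_factor_products: "x \<in> S \<Longrightarrow> x [^] (n::nat) \<in> factor_products R S n"
  by (induction n) auto

lemma factor_products_increase:
  assumes "ideal Z R" "S \<subseteq> carrier R" "factor_products R S n \<subseteq> Z" "n \<le> m"
  shows "factor_products R S m \<subseteq> Z"
  using assms(4,3)
proof (induction m rule: dec_induct)
  case (step m)
  then show ?case
    using assms(1,2) by (auto intro: ideal.I_r_closed)
qed auto

text \<open>Commutativity allows the factors from \<open>S\<close> and those from \<open>S'\<close>
  to be collected separately.\<close>

lemma factor_products_Un:
  assumes "S \<subseteq> carrier R" "S' \<subseteq> carrier R" "a \<in> factor_products R (S \<union> S') k"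
  shows "\<exists>i j u v. i + j = k \<and> u \<in> factor_products R S i \<and> v \<in> factor_products R S' j \<and> a = u \<otimes> v"
  using assms(3)
proof (induction k arbitrary: a)
  case (Suc k)
  then obtain b c where b: "b \<in> factor_products R (S \<union> S') k" "c \<in> S \<union> S'" "a = b \<otimes> c" by auto
  from Suc.IH[OF b(1)] obtain i j u v where
    *: "i + j = k" "u \<in> factor_products R S i" "v \<in> factor_products R S' j" "b = u \<otimes> v" by blast
  have car: "u \<in> carrier R" "v \<in> carrier R" "c \<in> carrier R"
    using factor_products_closed assms(1,2) * b(2) by blast+
  show ?case
  proof (cases "c \<in> S")
    case True
    then have "u \<otimes> c \<in> factor_products R S (Suc i)" using * by auto
    moreover have "a = (u \<otimes> c) \<otimes> v" using * b car by (simp add: m_ac)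
    moreover have "Suc i + j = Suc k" using * by simp
    ultimately show ?thesis using * by blast
  next
    case False
    then have "v \<otimes> c \<in> factor_products R S' (Suc j)" using * b by auto
    moreover have "a = u \<otimes> (v \<otimes> c)" using * b car by (simp add: m_ac)
    moreover have "i + Suc j = Suc k" using * by simp
    ultimately show ?thesis using * by blast
  qed
qed auto

text \<open>Pigeonhole: of n + m factors, at least n come from \<open>S\<close> or at least m from
  \<open>S'\<close>.\<close>

lemma nilpotent_Un:
  assumes Z: "ideal Z R" and S: "S \<subseteq> carrier R" "S' \<subseteq> carrier R"
    and "factor_products R S n \<subseteq> Z" "factor_products R S' m \<subseteq> Z"
  shows "factor_products R (S \<union> S') (n + m) \<subseteq> Z"
proof
  fix a assume "a \<in> factor_products R (S \<union> S') (n + m)"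
  from factor_products_Un[OF S this] obtain i j u v where
    *: "i + j = n + m" "u \<in> factor_products R S i" "v \<in> factor_products R S' j" "a = u \<otimes> v" by blast
  have car: "u \<in> carrier R" "v \<in> carrier R" using factor_products_closed S * by blast+
  from *(1) have "n \<le> i \<or> m \<le> j" by linarith
  then have "u \<in> Z \<or> v \<in> Z" using factor_products_increase[OF Z] assms * by blast
  then show "a \<in> Z" using * car Z by (auto intro: ideal.I_l_closed ideal.I_r_closed)
qed

lemma nilpotent_UN:
  assumes Z: "ideal Z R" and "finite A" and "\<And>i. i \<in> A \<Longrightarrow> S i \<subseteq> carrier R"
    and "\<And>i. i \<in> A \<Longrightarrow> \<exists>n. factor_products R (S i) n \<subseteq> Z"
  shows "\<exists>n. factor_products R (\<Union>i\<in>A. S i) n \<subseteq> Z"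
  using assms(2-)
proof (induction A rule: finite_induct)
  case empty
  \<comment> \<open>The exponent must be positive here: the empty product is one even if there are
    no factors to choose from.\<close>
  show ?case by (rule exI[of _ "Suc 0"]) auto
next
  case (insert i A)
  from insert.IH insert.prems obtain n where n: "factor_products R (\<Union>i\<in>A. S i) n \<subseteq> Z" by auto
  obtain m where m: "factor_products R (S i) m \<subseteq> Z" using insert.prems(2)[of i] by blast
  have "factor_products R (S i \<union> (\<Union>i\<in>A. S i)) (m + n) \<subseteq> Z"
    by (rule nilpotent_Un[OF Z _ _ m n]) (use insert.prems in auto)
  then show ?case by auto
qed

text \<open>This is the ideal quotient (Z : C).\<close>

lemma transporter_ideal:
  assumes Z: "ideal Z R" and "C \<subseteq> carrier R"
  shows "ideal {b \<in> carrier R. \<forall>c\<in>C. b \<otimes> c \<in> Z} R"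
proof -
  interpret Z: ideal Z R by fact
  show ?thesis
  proof (rule idealI)
    show "ring R" by (rule ring_axioms)
    show "subgroup {b \<in> carrier R. \<forall>c\<in>C. b \<otimes> c \<in> Z} (add_monoid R)"
    proof (rule group.subgroupI)
      show "Group.group (add_monoid R)" by (rule a_group)
      have "\<zero> \<in> {b \<in> carrier R. \<forall>c\<in>C. b \<otimes> c \<in> Z}" using assms(2) by auto
      then show "{b \<in> carrier R. \<forall>c\<in>C. b \<otimes> c \<in> Z} \<noteq> {}" by blast
    next
      fix a assume "a \<in> {b \<in> carrier R. \<forall>c\<in>C. b \<otimes> c \<in> Z}"
      then show "inv\<^bsub>add_monoid R\<^esub> a \<in> {b \<in> carrier R. \<forall>c\<in>C. b \<otimes> c \<in> Z}"
        unfolding a_inv_def[symmetric] using assms(2) by (auto simp: l_minus Z.a_inv_closed subset_iff)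
    qed (use assms(2) in \<open>auto simp: l_distr subset_iff\<close>)
  next
    fix a x assume "a \<in> {b \<in> carrier R. \<forall>c\<in>C. b \<otimes> c \<in> Z}" "x \<in> carrier R"
    then show "x \<otimes> a \<in> {b \<in> carrier R. \<forall>c\<in>C. b \<otimes> c \<in> Z}"
      "a \<otimes> x \<in> {b \<in> carrier R. \<forall>c\<in>C. b \<otimes> c \<in> Z}"
      using assms(2) by (auto simp: m_assoc Z.I_l_closed subset_iff m_comm[of a x])
  qed
qed

text \<open>Factors from the generated ideal are exchanged for generators one at a time; the
  multiplier \<open>a\<close> collects those already split off. Hence the exponent does not
  grow.\<close>

lemma factor_products_genideal_aux:
  assumes Z: "ideal Z R" and S: "S \<subseteq> carrier R" and "a \<in> carrier R"
    and "\<And>s. s \<in> factor_products R S n \<Longrightarrow> a \<otimes> s \<in> Z"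
    and "s \<in> factor_products R (genideal R S) n"
  shows "a \<otimes> s \<in> Z"
  using assms(3-5)
proof (induction n arbitrary: a s)
  case 0
  have "a \<otimes> \<one> \<in> Z" by (rule 0(2)) simp
  moreover have "s = \<one>" using 0(3) by simp
  ultimately show ?case by blast
next
  case (Suc n)
  have E: "genideal R S \<subseteq> carrier R"
    by (rule subsetI) (rule ideal.Icarr[OF genideal_ideal[OF S]])
  obtain u b where s: "u \<in> factor_products R (genideal R S) n" "b \<in> genideal R S" "s = u \<otimes> b"
    using Suc.prems(3) by auto
  have sub: "factor_products R S n \<subseteq> carrier R" by (rule factor_products_closed[OF S])
  let ?C = "(\<lambda>w. a \<otimes> w) ` factor_products R S n"
  \<comment> \<open>The possible last factors form an ideal. It contains \<open>S\<close>, hence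
    also \<open>genideal R S\<close>, and \<open>b\<close> can then be moved into the
    multiplier.\<close>
  let ?T = "{b \<in> carrier R. \<forall>c\<in>?C. b \<otimes> c \<in> Z}"
  have C: "?C \<subseteq> carrier R" using sub Suc.prems(1) by blast
  have "t \<otimes> (a \<otimes> w) \<in> Z" if "t \<in> S" "w \<in> factor_products R S n" for t w
  proof -
    have "a \<otimes> (w \<otimes> t) \<in> Z" by (rule Suc.prems(2)) (use that in auto)
    moreover have "w \<in> carrier R" "t \<in> carrier R" using sub that S by auto
    ultimately show ?thesis using Suc.prems(1) by (simp add: m_ac)
  qed
  then have "S \<subseteq> ?T" using S by blast
  with transporter_ideal[OF Z C] have "genideal R S \<subseteq> ?T" by (rule genideal_minimal)
  then have b: "b \<in> carrier R" "b \<otimes> (a \<otimes> w) \<in> Z" if "w \<in> factor_products R S n" for w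
    using s(2) that by blast+
  have bc: "b \<in> carrier R" using s(2) E by blast
  have "(b \<otimes> a) \<otimes> u \<in> Z"
  proof (rule Suc.IH[OF _ _ s(1)])
    show "b \<otimes> a \<in> carrier R" using bc Suc.prems(1) by simp
    fix w assume "w \<in> factor_products R S n"
    then show "b \<otimes> a \<otimes> w \<in> Z" using b(2) bc Suc.prems(1) sub by (simp add: m_assoc subset_iff)
  qed
  moreover have "u \<in> carrier R" using factor_products_closed[OF E] s(1) by blast
  ultimately show "a \<otimes> s \<in> Z" using s(3) bc Suc.prems(1) by (simp add: m_ac)
qed

lemma factor_products_genideal:
  assumes Z: "ideal Z R" and S: "S \<subseteq> carrier R" and n: "factor_products R S n \<subseteq> Z"
  shows "factor_products R (genideal R S) n \<subseteq> Z"
proof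
  fix s assume s: "s \<in> factor_products R (genideal R S) n"
  have "\<one> \<otimes> s \<in> Z"
  proof (rule factor_products_genideal_aux[OF Z S one_closed _ s])
    fix w assume "w \<in> factor_products R S n"
    then show "\<one> \<otimes> w \<in> Z" using n factor_products_closed[OF S, of n] by (simp add: subset_iff)
  qed
  moreover have "s \<in> carrier R"
    using s factor_products_closed[of "genideal R S" n] ideal.Icarr[OF genideal_ideal[OF S]] by blast
  ultimately show "s \<in> Z" by simp
qed

lemma finsum_in_ideal:
  assumes "ideal I R" "\<And>i. i \<in> A \<Longrightarrow> f i \<in> I"
  shows "finsum R f A \<in> I"
proof -
  interpret I: ideal I R by fact
  show ?thesis
    using assms(2)
  proof (induction A rule: infinite_finite_induct)
    case (insert i A)
    then have "f \<in> A \<rightarrow> carrier R" "f i \<in> carrier R" by auto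
    with insert show ?case by (simp add: finsum_insert)
  qed (auto simp: finsum_infinite)
qed

lemma finprod_in_ideal:
  assumes "ideal I R" "finite A" "i \<in> A" "f i \<in> I" "f \<in> A \<rightarrow> carrier R"
  shows "finprod R f A \<in> I"
proof -
  interpret I: ideal I R by fact
  have "finprod R f A = f i \<otimes> finprod R f (A - {i})"
    using assms(2,3,5) finprod_insert[of "A - {i}" i f] by (simp add: insert_absorb Pi_iff)
  moreover have "finprod R f (A - {i}) \<in> carrier R"
    using assms by (intro finprod_closed) auto
  ultimately show ?thesis using assms I.I_r_closed by simp
qed

end

lemma (in ring_hom_cring) vimage_ideal:
  assumes "ideal E S"
  shows "ideal {x \<in> carrier R. h x \<in> E} R"
proof -
  interpret E: ideal E S by fact
  show ?thesis
  proof (rule idealI)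
    show "ring R" by (rule R.ring_axioms)
    show "subgroup {x \<in> carrier R. h x \<in> E} (add_monoid R)"
    proof (rule group.subgroupI)
      show "Group.group (add_monoid R)" by (rule R.a_group)
      have "\<zero>\<^bsub>R\<^esub> \<in> {x \<in> carrier R. h x \<in> E}" by auto
      then show "{x \<in> carrier R. h x \<in> E} \<noteq> {}" by blast
    next
      fix a assume "a \<in> {x \<in> carrier R. h x \<in> E}"
      then show "inv\<^bsub>add_monoid R\<^esub> a \<in> {x \<in> carrier R. h x \<in> E}"
        unfolding a_inv_def[symmetric] by (auto simp: E.a_inv_closed)
    qed auto
  qed (auto simp: E.I_l_closed E.I_r_closed)
qed

section \<open>Tambara functors and their ideals\<close>

locale tambara = group G for G :: "('g, 'b) monoid_scheme" (structure) +
  fixes T :: "('g, 'a, 'c) tambara_data_scheme"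
  assumes finite_carrier: "finite (carrier G)" and is_tambara: "tambara_functor G T"
begin

section \<open>Conjugates of subgroups\<close>

lemma subgroup_finite: "subgroup H G \<Longrightarrow> finite H"
  using finite_carrier finite_subset subgroup.subset by blast

lemma conjset_subgroup:
  assumes "g \<in> carrier G" "subgroup H G"
  shows "subgroup (conjset G g H) G"
proof -
  have "(\<lambda>h. g \<otimes> h \<otimes> inv g) \<in> hom G G"
    using assms(1) by (auto intro!: homI simp: m_assoc inv_solve_left)
  then have "group_hom G G (\<lambda>h. g \<otimes> h \<otimes> inv g)"
    by (simp add: group_hom_def group_hom_axioms_def)
  then show ?thesis
    unfolding conjset_def using assms(2) by (rule group_hom.subgroup_img_is_subgroup)
qed

lemma conjset_conjset:
  assumes "g \<in> carrier G" "h \<in> carrier G" "H \<subseteq> carrier G"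
  shows "conjset G h (conjset G g H) = conjset G (h \<otimes> g) H"
  unfolding conjset_def image_image
  using assms by (intro image_cong) (auto simp: m_assoc inv_mult_group subset_iff)

lemma conjset_mono: "K \<subseteq> H \<Longrightarrow> conjset G g K \<subseteq> conjset G g H"
  by (auto simp: conjset_def)

lemma conjset_one: "H \<subseteq> carrier G \<Longrightarrow> conjset G \<one> H = H"
  by (auto simp: conjset_def subset_iff image_iff)

lemma conjset_self:
  assumes "subgroup H G" "h \<in> H"
  shows "conjset G h H = H"
proof -
  interpret H: subgroup H G by fact
  have sub: "conjset G k H \<subseteq> H" if "k \<in> H" for k
    using that by (auto simp: conjset_def)
  have "H = conjset G h (conjset G (inv h) H)"
    using assms(2) by (simp add: conjset_conjset conjset_one H.subset)
  also have "\<dots> \<subseteq> conjset G h H"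
    using sub[of "inv h"] assms(2) by (intro conjset_mono) auto
  finally show ?thesis using sub[OF assms(2)] by blast
qed

lemma conjset_le:
  "g \<in> carrier G \<Longrightarrow> subgrp_le G K H \<Longrightarrow> subgrp_le G (conjset G g K) (conjset G g H)"
  unfolding subgrp_le_def using conjset_subgroup conjset_mono by blast

lemma conjset_inv:
  assumes "g \<in> carrier G" "H \<subseteq> carrier G"
  shows "conjset G g (conjset G (inv g) H) = H" "conjset G (inv g) (conjset G g H) = H"
  using assms by (simp_all add: conjset_conjset conjset_one)

lemma subgrp_le_refl: "subgroup H G \<Longrightarrow> subgrp_le G H H"
  by (simp add: subgrp_le_def)

lemma subgrp_le_trans: "subgrp_le G L K \<Longrightarrow> subgrp_le G K H \<Longrightarrow> subgrp_le G L H"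
  by (auto simp: subgrp_le_def)

lemma subgrp_le_Int: "subgroup L G \<Longrightarrow> subgroup K G \<Longrightarrow> subgrp_le G (L \<inter> K) L"
  "subgroup L G \<Longrightarrow> subgroup K G \<Longrightarrow> subgrp_le G (L \<inter> K) K"
  by (simp_all add: subgrp_le_def subgroups_Inter_pair)

lemma subgrp_leD: "subgrp_le G K H \<Longrightarrow> subgroup K G" "subgrp_le G K H \<Longrightarrow> subgroup H G"
  "subgrp_le G K H \<Longrightarrow> K \<subseteq> H"
  by (simp_all add: subgrp_le_def)

section \<open>The axioms of a Tambara functor in usable form\<close>

lemmas functor_axioms1 = is_tambara[unfolded tambara_functor_def]
lemmas functor_axioms2 = functor_axioms1[THEN conjunct2]
lemmas functor_axioms3 = functor_axioms2[THEN conjunct2]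
lemmas functor_axioms4 = functor_axioms3[THEN conjunct2]
lemmas functor_axioms5 = functor_axioms4[THEN conjunct2]
lemmas functor_axioms6 = functor_axioms5[THEN conjunct2]
lemmas functor_axioms7 = functor_axioms6[THEN conjunct2]
lemmas functor_axioms8 = functor_axioms7[THEN conjunct2]
lemmas functor_axioms9 = functor_axioms8[THEN conjunct2]
lemmas functor_axioms10 = functor_axioms9[THEN conjunct2]
lemmas functor_axioms11 = functor_axioms10[THEN conjunct2]

lemma lev_cring: "subgroup H G \<Longrightarrow> cring (lev T H)"
  using functor_axioms1[THEN conjunct1] by blast

lemma lev_ring: "subgroup H G \<Longrightarrow> ring (lev T H)"
  using lev_cring cring_def by blast

lemma maps:
  assumes "subgrp_le G K H"
  shows res_hom: "res T H K \<in> ring_hom (lev T H) (lev T K)"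
    and tr_closed: "x \<in> carrier (lev T K) \<Longrightarrow> tr T H K x \<in> carrier (lev T H)"
    and tr_add: "x \<in> carrier (lev T K) \<Longrightarrow> y \<in> carrier (lev T K) \<Longrightarrow>
      tr T H K (x \<oplus>\<^bsub>lev T K\<^esub> y) = tr T H K x \<oplus>\<^bsub>lev T H\<^esub> tr T H K y"
    and nm_closed: "x \<in> carrier (lev T K) \<Longrightarrow> nm T H K x \<in> carrier (lev T H)"
    and nm_mult: "x \<in> carrier (lev T K) \<Longrightarrow> y \<in> carrier (lev T K) \<Longrightarrow>
      nm T H K (x \<otimes>\<^bsub>lev T K\<^esub> y) = nm T H K x \<otimes>\<^bsub>lev T H\<^esub> nm T H K y"
    and nm_one: "nm T H K \<one>\<^bsub>lev T K\<^esub> = \<one>\<^bsub>lev T H\<^esub>"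
  using functor_axioms2[THEN conjunct1] assms by blast+

lemma maps_id:
  assumes "subgroup H G" "x \<in> carrier (lev T H)"
  shows res_id: "res T H H x = x" and tr_id: "tr T H H x = x" and nm_id: "nm T H H x = x"
  using functor_axioms3[THEN conjunct1] assms by blast+

lemma res_res:
  assumes "subgrp_le G L K" "subgrp_le G K H" "x \<in> carrier (lev T H)"
  shows "res T K L (res T H K x) = res T H L x"
  using functor_axioms4[THEN conjunct1] assms by blast

lemma cj_iso:
  assumes "g \<in> carrier G" "subgroup H G"
  shows "cj T g H \<in> ring_iso (lev T H) (lev T (conjset G g H))"
  using functor_axioms5[THEN conjunct1] assms by blast

lemma cj_cj:
  assumes "g \<in> carrier G" "h \<in> carrier G" "subgroup H G" "x \<in> carrier (lev T H)"
  shows "cj T h (conjset G g H) (cj T g H x) = cj T (h \<otimes> g) H x"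
  using functor_axioms6[THEN conjunct1] assms by blast

lemma cj_self:
  assumes "subgroup H G" "h \<in> H" "x \<in> carrier (lev T H)"
  shows "cj T h H x = x"
  using functor_axioms7[THEN conjunct1] assms by blast

lemma cj_maps:
  assumes "g \<in> carrier G" "subgrp_le G K H"
  shows cj_res: "x \<in> carrier (lev T H) \<Longrightarrow>
      cj T g K (res T H K x) = res T (conjset G g H) (conjset G g K) (cj T g H x)"
    and cj_tr: "x \<in> carrier (lev T K) \<Longrightarrow>
      cj T g H (tr T H K x) = tr T (conjset G g H) (conjset G g K) (cj T g K x)"
    and cj_nm: "x \<in> carrier (lev T K) \<Longrightarrow>
      cj T g H (nm T H K x) = nm T (conjset G g H) (conjset G g K) (cj T g K x)"
  using functor_axioms8[THEN conjunct1] assms by blast+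

lemma double_coset:
  assumes "subgrp_le G K H" "subgrp_le G L H" "x \<in> carrier (lev T K)"
  shows res_tr: "res T H L (tr T H K x) =
      finsum (lev T L) (\<lambda>d. let g = dc_rep G H L K d; K' = conjset G g K in
        tr T L (L \<inter> K') (res T K' (L \<inter> K') (cj T g K x))) (dcosets G H L K)"
    and res_nm: "res T H L (nm T H K x) =
      finprod (lev T L) (\<lambda>d. let g = dc_rep G H L K d; K' = conjset G g K in
        nm T L (L \<inter> K') (res T K' (L \<inter> K') (cj T g K x))) (dcosets G H L K)"
  using functor_axioms9[THEN conjunct1] assms by blast+

lemma frobenius:
  assumes "subgrp_le G K H" "a \<in> carrier (lev T K)" "b \<in> carrier (lev T H)"
  shows "tr T H K (a \<otimes>\<^bsub>lev T K\<^esub> res T H K b) = tr T H K a \<otimes>\<^bsub>lev T H\<^esub> b"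
  using functor_axioms10[THEN conjunct1] assms by blast

lemma tambara_reciprocity:
  assumes "subgrp_le G K H" "a \<in> carrier (lev T K)" "b \<in> carrier (lev T K)"
  shows "nm T H K (a \<oplus>\<^bsub>lev T K\<^esub> b) = tambara_recip_rhs G T H K a b"
  using functor_axioms11 assms by blast

lemma res_closed:
  "subgrp_le G K H \<Longrightarrow> x \<in> carrier (lev T H) \<Longrightarrow> res T H K x \<in> carrier (lev T K)"
  using res_hom ring_hom_closed by metis

lemma cj_hom:
  "g \<in> carrier G \<Longrightarrow> subgroup H G \<Longrightarrow> cj T g H \<in> ring_hom (lev T H) (lev T (conjset G g H))"
  using cj_iso unfolding ring_iso_def by blast

lemma cj_closed:
  "g \<in> carrier G \<Longrightarrow> subgroup H G \<Longrightarrow> x \<in> carrier (lev T H) \<Longrightarrow>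
    cj T g H x \<in> carrier (lev T (conjset G g H))"
  using cj_hom ring_hom_closed by metis

lemma cj_one: "subgroup H G \<Longrightarrow> x \<in> carrier (lev T H) \<Longrightarrow> cj T \<one> H x = x"
  by (rule cj_self) (auto simp: subgroup.one_closed)

lemma cj_inv:
  assumes "g \<in> carrier G" "subgroup H G" "x \<in> carrier (lev T (conjset G g H))"
  shows "cj T g H (cj T (inv g) (conjset G g H) x) = x"
proof -
  have "cj T g (conjset G (inv g) (conjset G g H)) (cj T (inv g) (conjset G g H) x)
      = cj T (g \<otimes> inv g) (conjset G g H) x"
    using assms conjset_subgroup by (intro cj_cj) auto
  then show ?thesis
    using assms conjset_inv(2)[of g H] subgroup.subset[OF assms(2)]
    by (simp add: cj_one conjset_subgroup)
qed

text \<open>Unlike transfers and norms, a conjugation followed by a restriction respects the whole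
  ring structure, so ideals pull back along it and powers pass through it.\<close>

lemma res_cj_hom:
  assumes "g \<in> carrier G" "subgroup K G" "subgroup L G" "L \<subseteq> conjset G g K"
  shows "ring_hom_cring (lev T K) (lev T L) (\<lambda>y. res T (conjset G g K) L (cj T g K y))"
proof -
  have le: "subgrp_le G L (conjset G g K)"
    using assms conjset_subgroup by (simp add: subgrp_le_def)
  have "(res T (conjset G g K) L \<circ> cj T g K) \<in> ring_hom (lev T K) (lev T L)"
    using cj_hom[OF assms(1,2)] res_hom[OF le] by (rule ring_hom_trans)
  then show ?thesis
    using assms lev_cring by (simp add: ring_hom_cring_def ring_hom_cring_axioms_def comp_def)
qed

section \<open>Tambara ideals\<close>

lemma level_ideal: "tambara_ideal G T I \<Longrightarrow> subgroup H G \<Longrightarrow> ideal (I H) (lev T H)"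
  by (simp add: tambara_ideal_def)

lemma ideal_nonsub: "tambara_ideal G T I \<Longrightarrow> \<not> subgroup H G \<Longrightarrow> I H = {}"
  by (simp add: tambara_ideal_def)

lemma ideal_mem:
  assumes "tambara_ideal G T I" "x \<in> I H"
  shows ideal_subgroup: "subgroup H G" and ideal_carrier: "x \<in> carrier (lev T H)"
proof -
  show "subgroup H G" using assms ideal_nonsub by blast
  then show "x \<in> carrier (lev T H)" using assms level_ideal ideal.Icarr by metis
qed

lemma ideal_maps:
  assumes "tambara_ideal G T I" "subgrp_le G K H"
  shows ideal_res: "x \<in> I H \<Longrightarrow> res T H K x \<in> I K"
    and ideal_tr: "x \<in> I K \<Longrightarrow> tr T H K x \<in> I H"
    and ideal_nm: "x \<in> I K \<Longrightarrow> nm T H K x \<in> I H"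
  using assms by (auto simp: tambara_ideal_def image_subset_iff)

lemma ideal_cj:
  assumes "tambara_ideal G T I" "g \<in> carrier G" "x \<in> I H"
  shows "cj T g H x \<in> I (conjset G g H)"
  using assms ideal_subgroup[OF assms(1,3)] unfolding tambara_ideal_def by blast

lemma ideal_res_cj:
  assumes "tambara_ideal G T I" "g \<in> carrier G" "x \<in> I H" "subgroup L G" "L \<subseteq> conjset G g H"
  shows "res T (conjset G g H) L (cj T g H x) \<in> I L"
  using assms conjset_subgroup[OF assms(2) ideal_subgroup[OF assms(1,3)]]
  by (intro ideal_res[OF assms(1)] ideal_cj) (auto simp: subgrp_le_def)

text \<open>For conjugation an inclusion suffices: applied to \<open>inv g\<close> it gives the
  reverse one.\<close>

lemma tambara_idealI:
  assumes "\<And>H x. x \<in> I H \<Longrightarrow> subgroup H G"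
    and "\<And>H. subgroup H G \<Longrightarrow> ideal (I H) (lev T H)"
    and "\<And>H K x. subgrp_le G K H \<Longrightarrow> x \<in> I H \<Longrightarrow> res T H K x \<in> I K"
    and "\<And>H K x. subgrp_le G K H \<Longrightarrow> x \<in> I K \<Longrightarrow> tr T H K x \<in> I H"
    and "\<And>H K x. subgrp_le G K H \<Longrightarrow> x \<in> I K \<Longrightarrow> nm T H K x \<in> I H"
    and cj: "\<And>g H x. g \<in> carrier G \<Longrightarrow> x \<in> I H \<Longrightarrow> cj T g H x \<in> I (conjset G g H)"
  shows "tambara_ideal G T I"
proof -
  have "I (conjset G g H) \<subseteq> cj T g H ` I H" if g: "g \<in> carrier G" and H: "subgroup H G" for g H
  proof
    fix x assume x: "x \<in> I (conjset G g H)"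
    have "x \<in> carrier (lev T (conjset G g H))"
      using assms(2)[OF conjset_subgroup[OF g H]] x by (rule ideal.Icarr)
    then have "cj T g H (cj T (inv g) (conjset G g H) x) = x" by (rule cj_inv[OF g H])
    moreover have "cj T (inv g) (conjset G g H) x \<in> I H"
      using cj[OF _ x, of "inv g"] g conjset_inv(2)[OF g subgroup.subset[OF H]] by simp
    ultimately show "x \<in> cj T g H ` I H" by (metis image_eqI)
  qed
  moreover have "I H = {}" if "\<not> subgroup H G" for H using assms(1) that by blast
  moreover have "cj T g H ` I H \<subseteq> I (conjset G g H)" if "g \<in> carrier G" for g H
    using cj[OF that] by blast
  ultimately show ?thesis
    unfolding tambara_ideal_def using assms(2-5) by (auto simp: image_subset_iff)
qed

lemma unit_ideal: "tambara_ideal G T (unit_ideal G T)"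
proof (rule tambara_idealI)
  fix H assume "subgroup H G"
  then show "ideal (unit_ideal G T H) (lev T H)"
    using ring.oneideal[OF lev_ring] by (simp add: unit_ideal_def)
qed (auto simp: unit_ideal_def subgrp_le_def conjset_subgroup split: if_splits
  intro!: res_closed tr_closed nm_closed cj_closed)

lemma le_unit_ideal: "tambara_ideal G T I \<Longrightarrow> I \<le> unit_ideal G T"
  using ideal_subgroup ideal_carrier by (auto simp: le_fun_def unit_ideal_def)

section \<open>Generated ideals, products and powers\<close>

lemma INT_ideal:
  assumes "\<A> \<noteq> {}" "\<And>I. I \<in> \<A> \<Longrightarrow> tambara_ideal G T I"
  shows "tambara_ideal G T (\<lambda>H. \<Inter>I\<in>\<A>. I H)"
proof (rule tambara_idealI)
  fix H assume H: "subgroup H G"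
  have "ideal (\<Inter> ((\<lambda>I. I H) ` \<A>)) (lev T H)"
    by (rule ring.i_Intersect[OF lev_ring[OF H]]) (use assms level_ideal H in auto)
  then show "ideal (\<Inter>I\<in>\<A>. I H) (lev T H)" .
next
  fix H x assume "x \<in> (\<Inter>I\<in>\<A>. I H)"
  then show "subgroup H G" using assms ideal_subgroup by blast
qed (auto intro: ideal_maps ideal_cj assms(2))

text \<open>This guarantees that \<open>unit_ideal\<close> contains the generators. If no Tambara
  ideal did, the intersection in \<open>gen_ideal\<close> would be the whole type at every
  level.\<close>

definition valid :: "('g set \<times> 'a) set \<Rightarrow> bool" where
  "valid X \<longleftrightarrow> (\<forall>(H, x)\<in>X. subgroup H G \<and> x \<in> carrier (lev T H))"

lemma gen_ideal_alt:
  "gen_ideal G T X = (\<lambda>H. \<Inter>I\<in>{I. tambara_ideal G T I \<and> (\<forall>(K, x)\<in>X. x \<in> I K)}. I H)"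
  by (auto simp: gen_ideal_def)

lemma gen_ideal:
  assumes "valid X" shows "tambara_ideal G T (gen_ideal G T X)"
  unfolding gen_ideal_alt
proof (rule INT_ideal)
  have "unit_ideal G T \<in> {I. tambara_ideal G T I \<and> (\<forall>(K, x)\<in>X. x \<in> I K)}"
    using assms unit_ideal by (auto simp: valid_def unit_ideal_def)
  then show "{I. tambara_ideal G T I \<and> (\<forall>(K, x)\<in>X. x \<in> I K)} \<noteq> {}" by blast
qed auto

lemma gen_ideal_mem: "(H, x) \<in> X \<Longrightarrow> x \<in> gen_ideal G T X H"
  by (auto simp: gen_ideal_def)

lemma gen_ideal_least:
  "tambara_ideal G T I \<Longrightarrow> (\<And>K x. (K, x) \<in> X \<Longrightarrow> x \<in> I K) \<Longrightarrow> gen_ideal G T X \<le> I"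
  unfolding gen_ideal_def le_fun_def by blast

abbreviation principal :: "'g set \<Rightarrow> 'a \<Rightarrow> ('g, 'a) fam" where
  "principal H x \<equiv> gen_ideal G T {(H, x)}"

lemma principal:
  assumes "subgroup H G" "x \<in> carrier (lev T H)"
  shows "tambara_ideal G T (principal H x)" "x \<in> principal H x H"
  using assms by (auto intro!: gen_ideal gen_ideal_mem simp: valid_def)

lemma principal_le: "tambara_ideal G T I \<Longrightarrow> x \<in> I H \<Longrightarrow> principal H x \<le> I"
  by (rule gen_ideal_least) auto

abbreviation prod_gens :: "('g, 'a) fam \<Rightarrow> ('g, 'a) fam \<Rightarrow> ('g set \<times> 'a) set" where
  "prod_gens I J \<equiv> {(H, x \<otimes>\<^bsub>lev T H\<^esub> y) | H x y. subgroup H G \<and> x \<in> I H \<and> y \<in> J H}"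

lemma prod_gens_valid:
  assumes "tambara_ideal G T I" "tambara_ideal G T J"
  shows "valid (prod_gens I J)"
proof -
  have "x \<otimes>\<^bsub>lev T H\<^esub> y \<in> carrier (lev T H)" if "subgroup H G" "x \<in> I H" "y \<in> J H" for H x y
  proof -
    interpret cring "lev T H" using lev_cring that by simp
    show ?thesis using that ideal_carrier assms by simp
  qed
  then show ?thesis by (auto simp: valid_def)
qed

lemma ideal_prod:
  assumes "tambara_ideal G T I" "tambara_ideal G T J"
  shows "tambara_ideal G T (ideal_prod G T I J)"
  unfolding ideal_prod_def using prod_gens_valid[OF assms] by (rule gen_ideal)

lemma ideal_prod_mem:
  assumes "tambara_ideal G T I" "x \<in> I H" "y \<in> J H"
  shows "x \<otimes>\<^bsub>lev T H\<^esub> y \<in> ideal_prod G T I J H"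
  unfolding ideal_prod_def using assms ideal_subgroup by (intro gen_ideal_mem) blast

lemma ideal_prod_least:
  assumes "tambara_ideal G T P" "\<And>H x y. x \<in> I H \<Longrightarrow> y \<in> J H \<Longrightarrow> x \<otimes>\<^bsub>lev T H\<^esub> y \<in> P H"
  shows "ideal_prod G T I J \<le> P"
  unfolding ideal_prod_def using assms by (intro gen_ideal_least) auto

lemma ideal_prod_le:
  assumes "tambara_ideal G T I" "tambara_ideal G T J"
  shows "ideal_prod G T I J \<le> inf I J"
proof (rule le_infI)
  have "x \<otimes>\<^bsub>lev T H\<^esub> y \<in> I H \<and> x \<otimes>\<^bsub>lev T H\<^esub> y \<in> J H" if "x \<in> I H" "y \<in> J H" for H x y
    using that level_ideal[OF assms(1)] level_ideal[OF assms(2)] ideal_subgroup[OF assms(1)]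
      ideal_carrier[OF assms(1)] ideal_carrier[OF assms(2)]
    by (metis ideal.I_l_closed ideal.I_r_closed)
  then show "ideal_prod G T I J \<le> I" "ideal_prod G T I J \<le> J"
    using assms by (auto intro!: ideal_prod_least)
qed

lemma ideal_prod_mono:
  assumes "tambara_ideal G T I'" "tambara_ideal G T J'" "I \<le> I'" "J \<le> J'"
  shows "ideal_prod G T I J \<le> ideal_prod G T I' J'"
  using assms by (intro ideal_prod_least ideal_prod ideal_prod_mem) (auto simp: le_fun_def)

lemma ideal_pow: "tambara_ideal G T I \<Longrightarrow> tambara_ideal G T (ideal_pow G T I n)"
  by (induction n) (auto simp: unit_ideal ideal_prod)

lemma ideal_pow_Suc_le: "tambara_ideal G T I \<Longrightarrow> ideal_pow G T I (Suc n) \<le> ideal_pow G T I n"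
  using ideal_prod_le[OF ideal_pow[of I n], of I] le_unit_ideal[of I] by (cases n) auto

lemma ideal_pow_antimono:
  assumes "tambara_ideal G T I" "n \<le> m"
  shows "ideal_pow G T I m \<le> ideal_pow G T I n"
  using assms(2) by (induction m rule: dec_induct)
    (use ideal_pow_Suc_le[OF assms(1)] order_trans in blast)+

lemma ideal_pow_mono:
  assumes "tambara_ideal G T I" "tambara_ideal G T J" "I \<le> J"
  shows "ideal_pow G T I n \<le> ideal_pow G T J n"
  by (induction n) (use assms in \<open>auto intro!: ideal_prod_mono ideal_pow\<close>)

text \<open>The case n = 0 stands apart because the first power is \<open>I\<close> itself and not a
  product with the unit ideal.\<close>

lemma ideal_pow_mult:
  assumes "tambara_ideal G T I" "x \<in> ideal_pow G T I n H" "y \<in> I H"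
  shows "x \<otimes>\<^bsub>lev T H\<^esub> y \<in> ideal_pow G T I (Suc n) H"
proof (cases "n = 0")
  case True
  then show ?thesis
    using assms ideal_carrier[OF ideal_pow[OF assms(1)] assms(2)] ideal_subgroup[OF assms(1,3)]
    by (auto intro: ideal.I_l_closed level_ideal)
next
  case False
  then show ?thesis using assms by (auto intro: ideal_prod_mem ideal_pow)
qed

text \<open>This is the easy comparison between ring powers and Tambara powers. For principal
  ideals, a bound in the other direction, modulo \<open>I\<close>, is the work of the next
  section.\<close>

lemma factor_products_le_ideal_pow:
  assumes "tambara_ideal G T I" "subgroup H G"
  shows "factor_products (lev T H) (I H) n \<subseteq> ideal_pow G T I n H"
proof (induction n)
  case 0
  interpret cring "lev T H" using lev_cring assms by simp
  show ?case using assms by (auto simp: unit_ideal_def)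
next
  case (Suc n)
  then show ?case using ideal_pow_mult[OF assms(1)] by (auto simp del: ideal_pow.simps)
qed

section \<open>Radicals are computed levelwise\<close>

text \<open>To bound the level L of a generated Tambara ideal J, restrict attention to the elements of J
  all of whose conjugates restrict into E; the double coset formulas show that these form a
  Tambara ideal.\<close>

lemma gen_ideal_level_bound:
  assumes L: "subgroup L G" and E: "ideal E (lev T L)" and X: "valid X"
    and tr: "\<And>K y. subgroup K G \<Longrightarrow> K \<subset> L \<Longrightarrow> y \<in> gen_ideal G T X K \<Longrightarrow> tr T L K y \<in> E"
    and nm: "\<And>K y. subgroup K G \<Longrightarrow> K \<subset> L \<Longrightarrow> y \<in> gen_ideal G T X K \<Longrightarrow> nm T L K y \<in> E"
    and gens: "\<And>K x g. (K, x) \<in> X \<Longrightarrow> g \<in> carrier G \<Longrightarrow> L \<subseteq> conjset G g K \<Longrightarrow>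
      res T (conjset G g K) L (cj T g K x) \<in> E"
  shows "gen_ideal G T X L \<subseteq> E"
proof -
  let ?J = "gen_ideal G T X"
  define J' where "J' = (\<lambda>K. {y \<in> ?J K. \<forall>g\<in>carrier G. L \<subseteq> conjset G g K \<longrightarrow>
    res T (conjset G g K) L (cj T g K y) \<in> E})"
  have J: "tambara_ideal G T ?J" using X by (rule gen_ideal)
  have J'D: "y \<in> ?J K" if "y \<in> J' K" for y K using that by (simp add: J'_def)
  have J'E: "res T (conjset G g K) L (cj T g K y) \<in> E"
    if "y \<in> J' K" "g \<in> carrier G" "L \<subseteq> conjset G g K" for y K g
    using that by (simp add: J'_def)
  have J'I: "y \<in> J' K" if "y \<in> ?J K" "\<And>g. g \<in> carrier G \<Longrightarrow> L \<subseteq> conjset G g K \<Longrightarrow>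
    res T (conjset G g K) L (cj T g K y) \<in> E" for y K
    using that by (simp add: J'_def)
  \<comment> \<open>There are two cases. If the conjugate contains \<open>L\<close>, transfer and
    norm go from \<open>L\<close> to itself and are the identity, so the condition defining
    \<open>J'\<close> applies. Otherwise the intersection is a proper subgroup of \<open>L\<close>,
    and the hypotheses \<open>tr\<close> and \<open>nm\<close> apply.\<close>
  have summand: "tr T L (L \<inter> conjset G a K) (res T (conjset G a K) (L \<inter> conjset G a K) (cj T a K y)) \<in> E"
    "nm T L (L \<inter> conjset G a K) (res T (conjset G a K) (L \<inter> conjset G a K) (cj T a K y)) \<in> E"
    if y: "y \<in> J' K" and a: "a \<in> carrier G" for y K a
  proof -
    let ?K = "conjset G a K"
    have K: "subgroup K G" using ideal_subgroup[OF J J'D[OF y]] .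
    note sub = conjset_subgroup[OF a K]
    have r: "res T ?K (L \<inter> ?K) (cj T a K y) \<in> ?J (L \<inter> ?K)"
      by (rule ideal_res_cj[OF J a J'D[OF y] subgrp_leD(1)[OF subgrp_le_Int(1)[OF L sub]]]) simp
    show "tr T L (L \<inter> ?K) (res T ?K (L \<inter> ?K) (cj T a K y)) \<in> E"
      "nm T L (L \<inter> ?K) (res T ?K (L \<inter> ?K) (cj T a K y)) \<in> E"
    proof (atomize (full), cases "L \<subseteq> ?K")
      case True
      then have "L \<inter> ?K = L" by blast
      then show "tr T L (L \<inter> ?K) (res T ?K (L \<inter> ?K) (cj T a K y)) \<in> E \<and>
          nm T L (L \<inter> ?K) (res T ?K (L \<inter> ?K) (cj T a K y)) \<in> E"
        using J'E[OF y a True] ideal.Icarr[OF E] by (simp add: maps_id[OF L])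
    next
      case False
      then have "L \<inter> ?K \<subset> L" by blast
      then show "tr T L (L \<inter> ?K) (res T ?K (L \<inter> ?K) (cj T a K y)) \<in> E \<and>
          nm T L (L \<inter> ?K) (res T ?K (L \<inter> ?K) (cj T a K y)) \<in> E"
        using tr nm r subgrp_leD(1)[OF subgrp_le_Int(1)[OF L sub]] by simp
    qed
  qed
  have transfer_norm: "tr T H K y \<in> J' H" "nm T H K y \<in> J' H" if le: "subgrp_le G K H" and y: "y \<in> J' K" for H K y
  proof -
    have yJ: "y \<in> ?J K" and yc: "y \<in> carrier (lev T K)"
      using J'D[OF y] ideal_carrier[OF J] by auto
    have *: "res T (conjset G g H) L (cj T g H (tr T H K y)) \<in> E"
      "res T (conjset G g H) L (cj T g H (nm T H K y)) \<in> E"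
      if g: "g \<in> carrier G" and sub: "L \<subseteq> conjset G g H" for g
    proof -
      let ?H = "conjset G g H" and ?K = "conjset G g K" and ?y = "cj T g K y"
      interpret L: cring "lev T L" using lev_cring[OF L] .
      have leH: "subgrp_le G ?K ?H" using conjset_le[OF g le] .
      have leL: "subgrp_le G L ?H" using subgrp_leD[OF leH] L sub by (simp add: subgrp_le_def)
      have yc': "?y \<in> carrier (lev T ?K)" using cj_closed[OF g subgrp_leD(1)[OF le] yc] .
      have terms: "(let a = dc_rep G ?H L ?K d; K' = conjset G a ?K in
          tr T L (L \<inter> K') (res T K' (L \<inter> K') (cj T a ?K ?y))) \<in> E \<and>
        (let a = dc_rep G ?H L ?K d; K' = conjset G a ?K in
          nm T L (L \<inter> K') (res T K' (L \<inter> K') (cj T a ?K ?y))) \<in> E"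
        if d: "d \<in> dcosets G ?H L ?K" for d
      proof -
        have "\<exists>a. a \<in> ?H \<and> d = L <#> (a <# ?K)" using d by (auto simp: dcosets_def)
        then have "dc_rep G ?H L ?K d \<in> ?H"
          unfolding dc_rep_def by (rule someI2_ex) simp
        then have a: "dc_rep G ?H L ?K d \<in> carrier G" using subgroup.subset[OF subgrp_leD(2)[OF leH]] by blast
        \<comment> \<open>The two conjugations compose to the one by \<open>a \<otimes> g\<close>,
          which gives the term the shape treated in \<open>summand\<close>.\<close>
        show ?thesis
          using summand[OF y m_closed[OF a g]] a g subgrp_leD(1)[OF le] yc
          by (simp add: Let_def conjset_conjset subgroup.subset cj_cj)
      qed
      have "finsum (lev T L) (\<lambda>d. let a = dc_rep G ?H L ?K d; K' = conjset G a ?K in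
          tr T L (L \<inter> K') (res T K' (L \<inter> K') (cj T a ?K ?y))) (dcosets G ?H L ?K) \<in> E"
        by (rule L.finsum_in_ideal[OF E]) (use terms in blast)
      then show "res T ?H L (cj T g H (tr T H K y)) \<in> E"
        by (simp add: cj_tr[OF g le yc] res_tr[OF leH leL yc'])
      have fin: "finite (dcosets G ?H L ?K)"
        using subgroup_finite[OF subgrp_leD(2)[OF leH]] by (auto simp: dcosets_def)
      \<comment> \<open>The norm formula needs at least one double coset: an empty product would be
        one, which need not lie in \<open>E\<close>.\<close>
      have ne: "dcosets G ?H L ?K \<noteq> {}"
        using subgroup.one_closed[OF subgrp_leD(2)[OF leH]] by (auto simp: dcosets_def)
      then obtain d where d: "d \<in> dcosets G ?H L ?K" by blast
      have "finprod (lev T L) (\<lambda>d. let a = dc_rep G ?H L ?K d; K' = conjset G a ?K in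
          nm T L (L \<inter> K') (res T K' (L \<inter> K') (cj T a ?K ?y))) (dcosets G ?H L ?K) \<in> E"
        by (rule L.finprod_in_ideal[OF E fin d]) (use terms d ideal.Icarr[OF E] in blast)+
      then show "res T ?H L (cj T g H (nm T H K y)) \<in> E"
        by (simp add: cj_nm[OF g le yc] res_nm[OF leH leL yc'])
    qed
    show "tr T H K y \<in> J' H" "nm T H K y \<in> J' H"
      using * ideal_maps(2,3)[OF J le yJ] by (auto intro: J'I)
  qed
  have "tambara_ideal G T J'"
  proof (rule tambara_idealI)
    fix K x assume "x \<in> J' K"
    then show "subgroup K G" using J'D ideal_subgroup[OF J] by blast
  next
    fix K assume K: "subgroup K G"
    let ?A = "{g \<in> carrier G. L \<subseteq> conjset G g K}"
    let ?\<A> = "insert (?J K) ((\<lambda>g. {y \<in> carrier (lev T K). res T (conjset G g K) L (cj T g K y) \<in> E}) ` ?A)"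
    \<comment> \<open>Each condition cuts out the preimage of \<open>E\<close> under a ring
      homomorphism, so an intersection of ideals results.\<close>
    have "J' K = \<Inter> ?\<A>"
      using ideal_carrier[OF J] by (auto simp: J'_def)
    moreover have "ideal (\<Inter> ?\<A>) (lev T K)"
    proof (rule ring.i_Intersect[OF lev_ring[OF K]])
      fix I assume "I \<in> ?\<A>"
      then consider "I = ?J K" | g where "g \<in> carrier G" "L \<subseteq> conjset G g K"
        "I = {y \<in> carrier (lev T K). res T (conjset G g K) L (cj T g K y) \<in> E}" by blast
      then show "ideal I (lev T K)"
      proof cases
        case 1 then show ?thesis using level_ideal[OF J K] by simp
      next
        case (2 g)
        then show ?thesis
          using ring_hom_cring.vimage_ideal[OF res_cj_hom[OF 2(1) K L 2(2)] E] by simp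
      qed
    qed simp
    ultimately show "ideal (J' K) (lev T K)" by simp
  next
    fix H K y assume le: "subgrp_le G K H" and y: "y \<in> J' H"
    have yc: "y \<in> carrier (lev T H)" using ideal_carrier[OF J J'D[OF y]] .
    show "res T H K y \<in> J' K"
    proof (rule J'I)
      show "res T H K y \<in> ?J K" using ideal_res[OF J le J'D[OF y]] .
      fix g assume g: "g \<in> carrier G" and sub: "L \<subseteq> conjset G g K"
      note leH = conjset_le[OF g le]
      have leL: "subgrp_le G L (conjset G g K)" using subgrp_leD[OF leH] L sub by (simp add: subgrp_le_def)
      have "res T (conjset G g K) L (cj T g K (res T H K y)) = res T (conjset G g H) L (cj T g H y)"
        using cj_res[OF g le yc] res_res[OF leL leH] cj_closed[OF g subgrp_leD(2)[OF le] yc] by simp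
      then show "res T (conjset G g K) L (cj T g K (res T H K y)) \<in> E"
        using J'E[OF y g subgrp_leD(3)[OF subgrp_le_trans[OF leL leH]]] by simp
    qed
  next
    fix g H y assume g: "g \<in> carrier G" and y: "y \<in> J' H"
    have H: "subgroup H G" and yc: "y \<in> carrier (lev T H)"
      using ideal_subgroup[OF J J'D[OF y]] ideal_carrier[OF J J'D[OF y]] .
    show "cj T g H y \<in> J' (conjset G g H)"
    proof (rule J'I)
      show "cj T g H y \<in> ?J (conjset G g H)" using ideal_cj[OF J g J'D[OF y]] .
      fix h assume h: "h \<in> carrier G" and "L \<subseteq> conjset G h (conjset G g H)"
      then show "res T (conjset G h (conjset G g H)) L (cj T h (conjset G g H) (cj T g H y)) \<in> E"
        using J'E[OF y m_closed[OF h g]] cj_cj[OF g h H yc]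
          conjset_conjset[OF g h subgroup.subset[OF H]] by simp
    qed
  qed (fact transfer_norm)+
  moreover have "x \<in> J' K" if "(K, x) \<in> X" for K x
    using gen_ideal_mem[OF that] gens[OF that] by (rule J'I)
  ultimately have "?J \<le> J'" by (rule gen_ideal_least)
  show ?thesis
  proof
    fix y assume "y \<in> ?J L"
    then have y: "y \<in> J' L" using \<open>?J \<le> J'\<close> by (auto simp: le_fun_def)
    have "y \<in> carrier (lev T L)" using ideal_carrier[OF J J'D[OF y]] .
    \<comment> \<open>For the identity as conjugating element, the condition on \<open>y\<close>
      reduces to \<open>y \<in> E\<close>.\<close>
    moreover have "res T (conjset G \<one> L) L (cj T \<one> L y) \<in> E"
      using J'E[OF y, of \<one>] conjset_one[OF subgroup.subset[OF L]] by simp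
    ultimately show "y \<in> E"
      using conjset_one[OF subgroup.subset[OF L]] by (simp add: cj_one[OF L] maps_id[OF L])
  qed
qed

text \<open>By Frobenius reciprocity tr(v) tr(b) = tr(v res(tr(b))), and the new factor res(tr(b))
  is again in \<open>I K\<close>. The exponent is a successor because the empty product, one, need
  not be a transfer.\<close>

lemma factor_products_tr:
  assumes I: "tambara_ideal G T I" and le: "subgrp_le G K H"
  shows "factor_products (lev T H) (tr T H K ` I K) (Suc n) \<subseteq> tr T H K ` factor_products (lev T K) (I K) (Suc n)"
proof (induction n)
  case 0
  interpret K: cring "lev T K" using lev_cring subgrp_leD[OF le] by blast
  interpret H: cring "lev T H" using lev_cring subgrp_leD[OF le] by blast
  have "I K \<subseteq> carrier (lev T K)" using ideal_carrier[OF I] by blast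
  moreover have "tr T H K ` I K \<subseteq> carrier (lev T H)" using ideal_carrier[OF I] tr_closed[OF le] by blast
  ultimately show ?case by (simp only: K.factor_products_one H.factor_products_one)
next
  case (Suc n)
  interpret K: cring "lev T K" using lev_cring subgrp_leD[OF le] by blast
  have sub: "I K \<subseteq> carrier (lev T K)" using ideal_carrier[OF I] by blast
  show ?case
  proof
    fix s assume "s \<in> factor_products (lev T H) (tr T H K ` I K) (Suc (Suc n))"
    then obtain u b where u: "u \<in> factor_products (lev T H) (tr T H K ` I K) (Suc n)"
      and b: "b \<in> I K" and s: "s = u \<otimes>\<^bsub>lev T H\<^esub> tr T H K b"
      unfolding factor_products.simps(2)[of _ _ "Suc n"] by blast
    from u Suc.IH obtain v where v: "v \<in> factor_products (lev T K) (I K) (Suc n)" "u = tr T H K v" by blast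
    have "v \<in> carrier (lev T K)" using K.factor_products_closed[OF sub] v(1) by blast
    moreover have tb: "tr T H K b \<in> I H" using ideal_tr[OF I le b] .
    ultimately have "s = tr T H K (v \<otimes>\<^bsub>lev T K\<^esub> res T H K (tr T H K b))"
      using frobenius[OF le] ideal_carrier[OF I tb] v(2) s by simp
    moreover have "res T H K (tr T H K b) \<in> I K" using ideal_res[OF I le tb] .
    then have "v \<otimes>\<^bsub>lev T K\<^esub> res T H K (tr T H K b) \<in> factor_products (lev T K) (I K) (Suc (Suc n))"
      unfolding factor_products.simps(2)[of _ _ "Suc n"] using v(1) by blast
    ultimately show "s \<in> tr T H K ` factor_products (lev T K) (I K) (Suc (Suc n))" by blast
  qed
qed

lemma factor_products_nm:
  assumes le: "subgrp_le G K H" and A: "A \<subseteq> carrier (lev T K)"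
  shows "factor_products (lev T H) (nm T H K ` A) n \<subseteq> nm T H K ` factor_products (lev T K) A n"
proof (induction n)
  case 0
  show ?case using nm_one[OF le] by simp
next
  case (Suc n)
  interpret K: cring "lev T K" using lev_cring subgrp_leD[OF le] by blast
  show ?case
  proof
    fix s assume "s \<in> factor_products (lev T H) (nm T H K ` A) (Suc n)"
    then obtain u b where u: "u \<in> factor_products (lev T H) (nm T H K ` A) n"
      and b: "b \<in> A" and s: "s = u \<otimes>\<^bsub>lev T H\<^esub> nm T H K b"
      by auto
    from u Suc.IH obtain v where v: "v \<in> factor_products (lev T K) A n" "u = nm T H K v" by blast
    have "v \<in> carrier (lev T K)" using K.factor_products_closed[OF A] v(1) by blast
    then have "s = nm T H K (v \<otimes>\<^bsub>lev T K\<^esub> b)"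
      using nm_mult[OF le] A b v(2) s by auto
    moreover have "v \<otimes>\<^bsub>lev T K\<^esub> b \<in> factor_products (lev T K) A (Suc n)" using v(1) b by auto
    ultimately show "s \<in> nm T H K ` factor_products (lev T K) A (Suc n)" by blast
  qed
qed

lemma finite_subgroups: "finite {H. subgroup H G}"
  using finite_carrier by (rule finite_subset[rotated, OF finite_Collect_subsets])
    (auto dest: subgroup.subset)

lemma ring_hom_pow:
  assumes "ring_hom_cring R S h" "x \<in> carrier R"
  shows "h (x [^]\<^bsub>R\<^esub> (n::nat)) = h x [^]\<^bsub>S\<^esub> n"
proof -
  interpret ring_hom_cring R S h by fact
  show ?thesis using assms(2) by (induction n) auto
qed

text \<open>Given nilpotence modulo I at all proper subgroups of L, each of the three kinds of
  generators of J at the level L is nilpotent: Frobenius reciprocity turns a product of transfers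
  into the transfer of a product, and norms are multiplicative.\<close>

lemma principal_level_nilpotent:
  assumes I: "tambara_ideal G T I" and M: "subgroup M G" and x: "x \<in> carrier (lev T M)"
    and xn: "x [^]\<^bsub>lev T M\<^esub> (n::nat) \<in> I M" and L: "subgroup L G"
    and IH: "\<And>K. subgroup K G \<Longrightarrow> K \<subset> L \<Longrightarrow> ideal_pow G T (principal M x) (Suc k) K \<subseteq> I K"
  shows "\<exists>m. factor_products (lev T L) (principal M x L) m \<subseteq> I L"
proof -
  let ?J = "principal M x" and ?R = "lev T L"
  note J = principal(1)[OF M x]
  interpret L: cring ?R using lev_cring[OF L] .
  note IL = level_ideal[OF I L]
  let ?Ks = "{K. subgroup K G \<and> K \<subset> L}" and ?A = "{g \<in> carrier G. L \<subseteq> conjset G g M}"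
  have finK: "finite ?Ks" using finite_subgroups by (rule rev_finite_subset) auto
  have finA: "finite ?A" using finite_carrier by simp
  have le: "subgrp_le G K L" if "K \<in> ?Ks" for K using that L by (auto simp: subgrp_le_def)
  have JK: "?J K \<subseteq> carrier (lev T K)" for K using ideal_carrier[OF J] by blast
  have nilK: "factor_products (lev T K) (?J K) (Suc k) \<subseteq> I K" if "K \<in> ?Ks" for K
    using factor_products_le_ideal_pow[OF J, of K "Suc k"] IH[of K] that by blast
  define S1 where "S1 = (\<Union>g\<in>?A. {res T (conjset G g M) L (cj T g M x)})"
  define S2 where "S2 = (\<Union>K\<in>?Ks. tr T L K ` ?J K)"
  define S3 where "S3 = (\<Union>K\<in>?Ks. nm T L K ` ?J K)"
  have c1: "S1 \<subseteq> carrier ?R"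
    using ideal_res_cj[OF J _ principal(2)[OF M x] L] ideal_carrier[OF J] by (auto simp: S1_def)
  have c2: "S2 \<subseteq> carrier ?R" using JK tr_closed[OF le] by (fastforce simp: S2_def)
  have c3: "S3 \<subseteq> carrier ?R" using JK nm_closed[OF le] by (fastforce simp: S3_def)
  have "\<exists>m. factor_products ?R S1 m \<subseteq> I L"
    unfolding S1_def
  proof (rule L.nilpotent_UN[OF IL finA])
    fix g assume g: "g \<in> ?A"
    let ?y = "res T (conjset G g M) L (cj T g M x)"
    show y: "{?y} \<subseteq> carrier ?R" using c1 g by (auto simp: S1_def)
    have "?y [^]\<^bsub>?R\<^esub> n = res T (conjset G g M) L (cj T g M (x [^]\<^bsub>lev T M\<^esub> n))"
      using ring_hom_pow[OF res_cj_hom[OF _ M L] x] g by simp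
    then have "?y [^]\<^bsub>?R\<^esub> n \<in> I L" using ideal_res_cj[OF I _ xn L] g by simp
    then show "\<exists>m. factor_products ?R {?y} m \<subseteq> I L"
      using L.factor_products_singleton y by (intro exI[of _ n]) auto
  qed
  moreover have "\<exists>m. factor_products ?R S2 m \<subseteq> I L"
    unfolding S2_def
  proof (rule L.nilpotent_UN[OF IL finK])
    fix K assume K: "K \<in> ?Ks"
    show "tr T L K ` ?J K \<subseteq> carrier ?R" using c2 K by (auto simp: S2_def)
    have "factor_products ?R (tr T L K ` ?J K) (Suc k) \<subseteq> I L"
      using factor_products_tr[OF J le[OF K], of k] nilK[OF K] ideal_tr[OF I le[OF K]] by blast
    then show "\<exists>m. factor_products ?R (tr T L K ` ?J K) m \<subseteq> I L" by blast
  qed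
  moreover have "\<exists>m. factor_products ?R S3 m \<subseteq> I L"
    unfolding S3_def
  proof (rule L.nilpotent_UN[OF IL finK])
    fix K assume K: "K \<in> ?Ks"
    show "nm T L K ` ?J K \<subseteq> carrier ?R" using c3 K by (auto simp: S3_def)
    have "factor_products ?R (nm T L K ` ?J K) (Suc k) \<subseteq> I L"
      using factor_products_nm[OF le[OF K] JK, of "Suc k"] nilK[OF K] ideal_nm[OF I le[OF K]] by blast
    then show "\<exists>m. factor_products ?R (nm T L K ` ?J K) m \<subseteq> I L" by blast
  qed
  ultimately obtain m1 m2 m3 where m: "factor_products ?R S1 m1 \<subseteq> I L"
    "factor_products ?R S2 m2 \<subseteq> I L" "factor_products ?R S3 m3 \<subseteq> I L" by blast
  have c: "S1 \<union> S2 \<union> S3 \<subseteq> carrier ?R" using c1 c2 c3 by blast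
  have nilS: "factor_products ?R (S1 \<union> S2 \<union> S3) (m1 + m2 + m3) \<subseteq> I L"
    by (intro L.nilpotent_Un[OF IL] m) (use c1 c2 c3 in auto)
  \<comment> \<open>The three sets are exactly the contributions listed in
    \<open>gen_ideal_level_bound\<close>. Passing from them to the generated ring ideal keeps the
    exponent.\<close>
  have "?J L \<subseteq> genideal ?R (S1 \<union> S2 \<union> S3)"
  proof (rule gen_ideal_level_bound[OF L L.genideal_ideal[OF c]])
    show "valid {(M, x)}" using M x by (simp add: valid_def)
  next
    fix K y assume "subgroup K G" "K \<subset> L" "y \<in> ?J K"
    then have "tr T L K y \<in> S2" "nm T L K y \<in> S3" unfolding S2_def S3_def by blast+
    then show "tr T L K y \<in> genideal ?R (S1 \<union> S2 \<union> S3)" "nm T L K y \<in> genideal ?R (S1 \<union> S2 \<union> S3)"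
      using L.genideal_self[OF c] by blast+
  next
    fix K z g assume "(K, z) \<in> {(M, x)}" "g \<in> carrier G" "L \<subseteq> conjset G g K"
    then have "res T (conjset G g K) L (cj T g K z) \<in> S1" unfolding S1_def by blast
    then show "res T (conjset G g K) L (cj T g K z) \<in> genideal ?R (S1 \<union> S2 \<union> S3)"
      using L.genideal_self[OF c] by blast
  qed
  then have "factor_products ?R (?J L) (m1 + m2 + m3) \<subseteq> I L"
    using L.factor_products_genideal[OF IL c nilS] by (rule order_trans[OF factor_products_mono])
  then show ?thesis by blast
qed

text \<open>With k and m the exponents known at the proper subgroups of L and for the ring ideal J(L), the
  factors of J(L) are absorbed one at a time: the (k + j)-th power of J at L, multiplied by m - j
  elements of J(L), lands in I(L).\<close>

lemma principal_pow_level: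
  assumes I: "tambara_ideal G T I" and M: "subgroup M G" and x: "x \<in> carrier (lev T M)"
    and xn: "x [^]\<^bsub>lev T M\<^esub> (n::nat) \<in> I M" and L: "subgroup L G"
    and IH: "\<And>K. subgroup K G \<Longrightarrow> K \<subset> L \<Longrightarrow> ideal_pow G T (principal M x) (Suc k) K \<subseteq> I K"
  shows "\<exists>m. ideal_pow G T (principal M x) m L \<subseteq> I L"
proof -
  let ?J = "principal M x" and ?R = "lev T L"
  note J = principal(1)[OF M x]
  interpret L: cring ?R using lev_cring[OF L] .
  note IL = level_ideal[OF I L]
  have JL: "?J L \<subseteq> carrier ?R" using ideal_carrier[OF J] by blast
  from principal_level_nilpotent[OF assms] obtain m
    where m: "factor_products ?R (?J L) m \<subseteq> I L" by blast
  have "a \<otimes>\<^bsub>?R\<^esub> s \<in> I L" if "j \<le> m" "a \<in> ideal_pow G T ?J (Suc k + j) L"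
    "s \<in> factor_products ?R (?J L) (m - j)" for j a s
    using that
  proof (induction j arbitrary: a s)
    case 0
    \<comment> \<open>For j = 0 the product \<open>s\<close> alone has m factors from J(L), so it
      lies in I(L) by the choice of \<open>m\<close>.\<close>
    then have "s \<in> I L" using m by auto
    then show ?case using ideal_carrier[OF ideal_pow[OF J] 0(2)] by (rule ideal.I_l_closed[OF IL])
  next
    case (Suc j)
    let ?C = "factor_products ?R (?J L) (m - Suc j)" and ?P = "ideal_pow G T ?J (Suc k + j)"
    \<comment> \<open>The claim is that \<open>a\<close> lies in this ideal quotient. Since
      \<open>a\<close> ranges over a level of a generated Tambara ideal,
      \<open>gen_ideal_level_bound\<close> reduces the claim to generators and proper
      subgroups.\<close>
    let ?E = "{b \<in> carrier ?R. \<forall>c\<in>?C. b \<otimes>\<^bsub>?R\<^esub> c \<in> I L}"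
    have C: "?C \<subseteq> carrier ?R" using L.factor_products_closed[OF JL] .
    have P: "tambara_ideal G T ?P" using ideal_pow[OF J] .
    have E: "ideal ?E ?R" using L.transporter_ideal[OF IL C] .
    have mono: "ideal_pow G T ?J (Suc k + Suc j) K \<subseteq> I K" if "subgroup K G" "K \<subset> L" for K
      using ideal_pow_antimono[OF J, of "Suc k" "Suc k + Suc j"] IH[OF that]
      by (auto simp: le_fun_def simp del: ideal_pow.simps)
    \<comment> \<open>The exponent \<open>Suc k + j\<close> is positive, so the recursion for powers
      takes its product branch.\<close>
    have eq: "ideal_pow G T ?J (Suc k + Suc j) = gen_ideal G T (prod_gens ?P ?J)"
      by (simp add: ideal_prod_def)
    have IE: "I L \<subseteq> ?E" using C ideal.Icarr[OF IL] ideal.I_r_closed[OF IL] by blast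
    have "gen_ideal G T (prod_gens ?P ?J) L \<subseteq> ?E"
    proof (rule gen_ideal_level_bound[OF L E prod_gens_valid[OF P J]])
      fix K y assume K: "subgroup K G" "K \<subset> L" "y \<in> gen_ideal G T (prod_gens ?P ?J) K"
      then have "y \<in> I K" using mono[OF K(1,2)] eq by auto
      moreover have "subgrp_le G K L" using K L by (auto simp: subgrp_le_def)
      ultimately show "tr T L K y \<in> ?E" "nm T L K y \<in> ?E"
        using IE ideal_maps(2,3)[OF I] by blast+
    next
      fix K z g assume "(K, z) \<in> prod_gens ?P ?J" and g: "g \<in> carrier G" and sub: "L \<subseteq> conjset G g K"
      then obtain u v where z: "z = u \<otimes>\<^bsub>lev T K\<^esub> v" and K: "subgroup K G"
        and u: "u \<in> ?P K" and v: "v \<in> ?J K" by blast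
      let ?h = "\<lambda>y. res T (conjset G g K) L (cj T g K y)"
      interpret h: ring_hom_cring "lev T K" ?R ?h by (rule res_cj_hom[OF g K L sub])
      have hz: "?h z = ?h u \<otimes>\<^bsub>?R\<^esub> ?h v"
        unfolding z using h.hom_mult ideal_carrier[OF P u] ideal_carrier[OF J v] by simp
      have hu: "?h u \<in> ?P L" and hv: "?h v \<in> ?J L"
        using ideal_res_cj[OF P g u L sub] ideal_res_cj[OF J g v L sub] by auto
      have car: "?h u \<in> carrier ?R" "?h v \<in> carrier ?R"
        using ideal_carrier[OF P hu] ideal_carrier[OF J hv] by auto
      have "(?h u \<otimes>\<^bsub>?R\<^esub> ?h v) \<otimes>\<^bsub>?R\<^esub> c \<in> I L" if c: "c \<in> ?C" for c
      proof -
        \<comment> \<open>One factor changes sides: \<open>?h v\<close> joins the ring factors,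
          whose number grows from \<open>m - Suc j\<close> to \<open>m - j\<close>, and
          \<open>?h u\<close> remains in the power \<open>Suc k + j\<close>, as the induction
          hypothesis demands.\<close>
        have "c \<otimes>\<^bsub>?R\<^esub> ?h v \<in> factor_products ?R (?J L) (Suc (m - Suc j))"
          using c hv by auto
        then have "?h u \<otimes>\<^bsub>?R\<^esub> (c \<otimes>\<^bsub>?R\<^esub> ?h v) \<in> I L"
          using Suc.IH[OF _ hu] Suc.prems(1) by (simp add: Suc_diff_Suc)
        then show ?thesis using car c C by (simp add: L.m_ac subset_iff)
      qed
      then show "?h z \<in> ?E" using car hz by simp
    qed
    then have "a \<in> ?E" using Suc.prems(2) eq by auto
    then show ?case using Suc.prems(3) by blast
  qed
  \<comment> \<open>For j = m there are no ring factors left, and one can be taken for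
    \<open>s\<close>.\<close>
  from this[of m] have "a \<otimes>\<^bsub>?R\<^esub> \<one>\<^bsub>?R\<^esub> \<in> I L" if "a \<in> ideal_pow G T ?J (Suc k + m) L" for a
    using that by simp
  moreover have "a \<in> carrier ?R" if "a \<in> ideal_pow G T ?J (Suc k + m) L" for a
    using ideal_carrier[OF ideal_pow[OF J] that] .
  ultimately have "ideal_pow G T ?J (Suc k + m) L \<subseteq> I L"
    using L.r_one by (intro subsetI) metis
  then show ?thesis by blast
qed

text \<open>Powers decrease, so a good exponent stays good. The eventual form lets finitely many
  levels share an exponent.\<close>

lemma eventually_ideal_pow:
  assumes "tambara_ideal G T J"
  shows "(\<forall>\<^sub>F k in sequentially. ideal_pow G T J k L \<subseteq> A) \<longleftrightarrow> (\<exists>k. ideal_pow G T J k L \<subseteq> A)"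
proof -
  have "ideal_pow G T J m L \<subseteq> ideal_pow G T J k L" if "k \<le> m" for k m
    using ideal_pow_antimono[OF assms that] by (rule le_funD)
  then show ?thesis unfolding eventually_sequentially by (meson order_refl order_trans)
qed

lemma principal_nilpotent:
  assumes I: "tambara_ideal G T I" and M: "subgroup M G" and x: "x \<in> carrier (lev T M)"
    and xn: "x [^]\<^bsub>lev T M\<^esub> (n::nat) \<in> I M"
  shows "\<exists>k\<ge>1. ideal_pow G T (principal M x) k \<le> I"
proof -
  let ?J = "principal M x"
  note J = principal(1)[OF M x]
  have level: "\<forall>\<^sub>F k in sequentially. ideal_pow G T ?J k L \<subseteq> I L" if "subgroup L G" for L
    using that
  proof (induction L rule: measure_induct_rule[of card])
    case (less L)
    let ?Ks = "{K. subgroup K G \<and> K \<subset> L}"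
    have "\<forall>\<^sub>F k in sequentially. \<forall>K\<in>?Ks. ideal_pow G T ?J k K \<subseteq> I K"
    proof (rule eventually_ball_finite)
      show "finite ?Ks" using finite_subgroups by (rule rev_finite_subset) auto
      show "\<forall>K\<in>?Ks. \<forall>\<^sub>F k in sequentially. ideal_pow G T ?J k K \<subseteq> I K"
        using less.IH psubset_card_mono[OF subgroup_finite[OF less.prems]] by blast
    qed
    \<comment> \<open>A successor is chosen as the common exponent:
      \<open>factor_products_tr\<close> asks for a nonempty product, and the recursion for powers
      has its product form only above a positive exponent.\<close>
    then have "\<exists>k. \<forall>K\<in>?Ks. ideal_pow G T ?J (Suc k) K \<subseteq> I K"
      unfolding eventually_sequentially using le_Suc_eq by blast
    then obtain k where "\<forall>K\<in>?Ks. ideal_pow G T ?J (Suc k) K \<subseteq> I K" ..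
    then show ?case
      unfolding eventually_ideal_pow[OF J] using principal_pow_level[OF assms less.prems] by blast
  qed
  have "\<forall>\<^sub>F k in sequentially. \<forall>L\<in>{H. subgroup H G}. ideal_pow G T ?J k L \<subseteq> I L"
    using finite_subgroups level by (intro eventually_ball_finite) auto
  then have "\<exists>k. \<forall>L\<in>{H. subgroup H G}. ideal_pow G T ?J (Suc k) L \<subseteq> I L"
    unfolding eventually_sequentially using le_Suc_eq by blast
  then obtain k where k: "\<forall>L\<in>{H. subgroup H G}. ideal_pow G T ?J (Suc k) L \<subseteq> I L" ..
  have "ideal_pow G T ?J (Suc k) \<le> I"
  proof (rule le_funI)
    fix L show "ideal_pow G T ?J (Suc k) L \<subseteq> I L"
      using k ideal_nonsub[OF ideal_pow[OF J], of L "Suc k"] by (cases "subgroup L G") auto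
  qed
  then show ?thesis by (intro exI[of _ "Suc k"]) simp
qed

text \<open>One inclusion holds because ring powers of x lie in powers of <x>; the other is
  \<open>principal_nilpotent\<close>. The exponent 0 does no harm: it says that one lies in
  \<open>I H\<close>, and then so does x.\<close>

lemma radical_eq:
  assumes I: "tambara_ideal G T I"
  shows "radical G T I = (\<lambda>H. {x. subgroup H G \<and> x \<in> carrier (lev T H) \<and>
    (\<exists>n::nat. x [^]\<^bsub>lev T H\<^esub> n \<in> I H)})"
proof (rule ext)
  fix H
  have "x [^]\<^bsub>lev T H\<^esub> n \<in> I H"
    if "subgroup H G" "x \<in> carrier (lev T H)" "ideal_pow G T (principal H x) n \<le> I" for x n
  proof -
    interpret cring "lev T H" using lev_cring that by simp
    have "x [^]\<^bsub>lev T H\<^esub> n \<in> ideal_pow G T (principal H x) n H"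
      using pow_in_factor_products[OF principal(2)[OF that(1,2)]]
        factor_products_le_ideal_pow[OF principal(1)[OF that(1,2)] that(1)] by blast
    then show ?thesis using that(3) by (auto simp: le_fun_def)
  qed
  then show "radical G T I H = {x. subgroup H G \<and> x \<in> carrier (lev T H) \<and>
    (\<exists>n::nat. x [^]\<^bsub>lev T H\<^esub> n \<in> I H)}"
    unfolding radical_def using principal_nilpotent[OF I] by (auto split: if_splits)
qed

section \<open>Closure properties of the radical\<close>

lemma radical_mono: "I \<le> J \<Longrightarrow> radical G T I \<le> radical G T J"
  unfolding radical_def by (intro le_funI) (auto intro: order_trans)

lemma le_radical:
  assumes "tambara_ideal G T I" shows "I \<le> radical G T I"
proof (rule le_funI, rule subsetI)
  fix H x assume x: "x \<in> I H"
  interpret cring "lev T H" using lev_cring ideal_subgroup[OF assms x] by simp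
  show "x \<in> radical G T I H"
    unfolding radical_eq[OF assms] using ideal_subgroup[OF assms x] ideal_carrier[OF assms x] x
    by (auto intro!: exI[of _ "Suc 0"])
qed

text \<open>If x is in the radical, so is all of <x>, since y in <x> gives <y>^n below <x>^n. This
  settles every closure condition that involves a single element. Only addition needs the levelwise
  form: if a^n and b^m lie in \<open>I H\<close>, so does (a + b)^(n + m).\<close>

lemma radical_ideal:
  assumes I: "tambara_ideal G T I"
  shows "tambara_ideal G T (radical G T I)"
proof -
  let ?R = "radical G T I"
  have principal_le: "principal H x \<le> ?R" if x: "x \<in> ?R H" for H x
  proof (rule le_funI, rule subsetI)
    fix K y assume y: "y \<in> principal H x K"
    have xH: "subgroup H G" "x \<in> carrier (lev T H)"
      using x by (auto simp: radical_def split: if_splits)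
    note Px = principal(1)[OF xH]
    obtain n where n: "n \<ge> 1" "ideal_pow G T (principal H x) n \<le> I"
      using x by (auto simp: radical_def split: if_splits)
    have yK: "subgroup K G" "y \<in> carrier (lev T K)"
      using ideal_subgroup[OF Px y] ideal_carrier[OF Px y] .
    have "ideal_pow G T (principal K y) n \<le> ideal_pow G T (principal H x) n"
      by (rule ideal_pow_mono[OF principal(1)[OF yK] Px principal_le[OF Px y]])
    then show "y \<in> ?R K" using n yK by (auto simp: radical_def)
  qed
  have sub: "subgroup H G" "x \<in> carrier (lev T H)" if "x \<in> ?R H" for x H
    using that by (auto simp: radical_def split: if_splits)
  have P: "tambara_ideal G T (principal H x)" "x \<in> principal H x H" if "x \<in> ?R H" for x H
    using principal sub[OF that] by auto
  have into: "y \<in> ?R K" if "y \<in> principal H x K" "x \<in> ?R H" for x y H K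
    using that principal_le by (auto simp: le_fun_def)
  show ?thesis
  proof (rule tambara_idealI)
    fix H assume H: "subgroup H G"
    interpret R: cring "lev T H" using lev_cring[OF H] .
    note IH = level_ideal[OF I H]
    show "ideal (?R H) (lev T H)"
    proof (rule idealI)
      show "ring (lev T H)" by (rule R.ring_axioms)
      show "subgroup (?R H) (add_monoid (lev T H))"
      proof (rule group.subgroupI)
        show "Group.group (add_monoid (lev T H))" by (rule R.a_group)
        show "?R H \<subseteq> carrier (add_monoid (lev T H))" using sub by auto
        have "\<zero>\<^bsub>lev T H\<^esub> \<in> ?R H"
          using le_radical[OF I] additive_subgroup.zero_closed[OF ideal.axioms(1)[OF IH]]
          by (auto simp: le_fun_def)
        then show "?R H \<noteq> {}" by blast
      next
        fix a assume a: "a \<in> ?R H"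
        have "\<ominus>\<^bsub>lev T H\<^esub> a \<in> principal H a H"
          using additive_subgroup.a_inv_closed[OF ideal.axioms(1)[OF level_ideal[OF P(1)[OF a] H]] P(2)[OF a]] .
        then show "inv\<^bsub>add_monoid (lev T H)\<^esub> a \<in> ?R H" using into a by (simp add: a_inv_def)
      next
        fix a b assume a: "a \<in> ?R H" and b: "b \<in> ?R H"
        obtain n m :: nat where nm: "a [^]\<^bsub>lev T H\<^esub> n \<in> I H" "b [^]\<^bsub>lev T H\<^esub> m \<in> I H"
          using a b by (auto simp: radical_eq[OF I])
        have ab: "{a, b} \<subseteq> carrier (lev T H)" using sub a b by auto
        have "factor_products (lev T H) ({a} \<union> {b}) (n + m) \<subseteq> I H"
          using ab nm by (intro R.nilpotent_Un[OF IH]) (auto simp: R.factor_products_singleton)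
        then have "factor_products (lev T H) (genideal (lev T H) {a, b}) (n + m) \<subseteq> I H"
          using R.factor_products_genideal[OF IH ab] by (simp add: insert_commute)
        moreover have "a \<oplus>\<^bsub>lev T H\<^esub> b \<in> genideal (lev T H) {a, b}"
          using R.genideal_self[OF ab] R.genideal_ideal[OF ab]
          by (intro additive_subgroup.a_closed[OF ideal.axioms(1)]) auto
        ultimately have "(a \<oplus>\<^bsub>lev T H\<^esub> b) [^]\<^bsub>lev T H\<^esub> (n + m) \<in> I H"
          using R.pow_in_factor_products by blast
        then show "a \<otimes>\<^bsub>add_monoid (lev T H)\<^esub> b \<in> ?R H"
          unfolding radical_eq[OF I] using H ab by auto
      qed
    next
      fix a b assume a: "a \<in> ?R H" and b: "b \<in> carrier (lev T H)"
      show "b \<otimes>\<^bsub>lev T H\<^esub> a \<in> ?R H" "a \<otimes>\<^bsub>lev T H\<^esub> b \<in> ?R H"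
        using ideal.I_l_closed[OF level_ideal[OF P(1)[OF a] H] P(2)[OF a] b]
          ideal.I_r_closed[OF level_ideal[OF P(1)[OF a] H] P(2)[OF a] b] into a by auto
    qed
  next
    fix H x assume "x \<in> ?R H"
    then show "subgroup H G" by (rule sub)
  next
    fix H K x assume "subgrp_le G K H" "x \<in> ?R H"
    then show "res T H K x \<in> ?R K" using into ideal_res[OF P(1) _ P(2)] by blast
  next
    fix H K x assume "subgrp_le G K H" "x \<in> ?R K"
    then show "tr T H K x \<in> ?R H" "nm T H K x \<in> ?R H"
      using into ideal_tr[OF P(1) _ P(2)] ideal_nm[OF P(1) _ P(2)] by blast+
  next
    fix g H x assume "g \<in> carrier G" "x \<in> ?R H"
    then show "cj T g H x \<in> ?R (conjset G g H)" using into ideal_cj[OF P(1) _ P(2)] by blast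
  qed
qed

text \<open>After \<open>radical_eq\<close> this is multiplication of exponents at a single
  level.\<close>

lemma radical_radical:
  assumes I: "tambara_ideal G T I"
  shows "radical G T (radical G T I) = radical G T I"
proof (rule antisym)
  show "radical G T (radical G T I) \<le> radical G T I"
  proof (rule le_funI, rule subsetI)
    fix H x assume "x \<in> radical G T (radical G T I) H"
    then obtain n m :: nat where x: "subgroup H G" "x \<in> carrier (lev T H)"
      "(x [^]\<^bsub>lev T H\<^esub> n) [^]\<^bsub>lev T H\<^esub> m \<in> I H"
      by (auto simp: radical_eq[OF radical_ideal[OF I]]) (auto simp: radical_eq[OF I])
    interpret cring "lev T H" using lev_cring x by simp
    show "x \<in> radical G T I H" unfolding radical_eq[OF I] using x by (auto simp: nat_pow_pow)
  qed
qed (rule le_radical[OF radical_ideal[OF I]])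

text \<open>Closure under roots is a condition on single elements, and as such visibly stable under
  intersections.\<close>

lemma RadId_iff:
  "I \<in> RadId G T \<longleftrightarrow> tambara_ideal G T I \<and>
    (\<forall>H x. subgroup H G \<longrightarrow> x \<in> carrier (lev T H) \<longrightarrow> (\<exists>n::nat. x [^]\<^bsub>lev T H\<^esub> n \<in> I H) \<longrightarrow> x \<in> I H)"
proof (cases "tambara_ideal G T I")
  case True
  have "radical G T I = I \<longleftrightarrow> radical G T I \<le> I" using le_radical[OF True] by auto
  then show ?thesis unfolding RadId_def using True radical_eq[OF True] by (auto simp: le_fun_def)
qed (simp add: RadId_def)

lemma RadIdD: "I \<in> RadId G T \<Longrightarrow> tambara_ideal G T I" "I \<in> RadId G T \<Longrightarrow> radical G T I = I"
  by (simp_all add: RadId_def)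

lemma radical_RadId: "tambara_ideal G T I \<Longrightarrow> radical G T I \<in> RadId G T"
  by (simp add: RadId_def radical_ideal radical_radical)

lemma RadId_inf:
  assumes "I \<in> RadId G T" "J \<in> RadId G T"
  shows "inf I J \<in> RadId G T"
proof -
  have "inf I J = (\<lambda>H. \<Inter>K\<in>{I, J}. K H)" by auto
  then have "tambara_ideal G T (inf I J)"
    using INT_ideal[of "{I, J}"] RadIdD(1) assms by auto
  then show ?thesis using assms unfolding RadId_iff by (simp add: inf_fun_def) blast
qed

lemma unit_RadId: "unit_ideal G T \<in> RadId G T"
  unfolding RadId_iff by (auto simp: unit_ideal) (auto simp: unit_ideal_def)

section \<open>Sums of Tambara ideals\<close>

text \<open>In Tambara reciprocity \<open>A\<close> is the set of cosets at which a function from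
  H/K to {a, b} takes the value \<open>b\<close>. This is the factor belonging to one orbit of the
  stabiliser of \<open>A\<close>.\<close>

definition recip_factor :: "'g set \<Rightarrow> 'g set \<Rightarrow> 'g set set \<Rightarrow> 'a \<Rightarrow> 'a \<Rightarrow> 'g set set \<Rightarrow> 'a" where
  "recip_factor H K A a b Orb =
     (let L = stab G H A; h = (SOME h. h \<in> H \<and> h <# K \<in> Orb); K' = conjset G h K in
        nm T L (L \<inter> K') (res T K' (L \<inter> K') (cj T h K (if h <# K \<in> A then b else a))))"

definition recip_summand :: "'g set \<Rightarrow> 'g set \<Rightarrow> 'a \<Rightarrow> 'a \<Rightarrow> 'g set set set \<Rightarrow> 'a" where
  "recip_summand H K a b \<Omega> =
     (let A = (SOME A. A \<in> \<Omega>); L = stab G H A in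
        tr T H L (finprod (lev T L) (recip_factor H K A a b) (point_orbits G H L K)))"

lemma recip_rhs: "tambara_recip_rhs G T H K a b = finsum (lev T H) (recip_summand H K a b) (subset_orbits G H K)"
  by (simp add: tambara_recip_rhs_def recip_summand_def[abs_def] recip_factor_def[abs_def] Let_def)

section \<open>Stabilisers and orbits on cosets\<close>

lemma l_coset_cosets_in:
  assumes "subgrp_le G K H" "h \<in> H" "C \<in> cosets_in G H K"
  shows "h <# C \<in> cosets_in G H K"
proof -
  interpret H: subgroup H G using subgrp_leD[OF assms(1)] by simp
  interpret K: subgroup K G using subgrp_leD[OF assms(1)] by simp
  from assms(3) obtain k where "k \<in> H" "C = k <# K" by (auto simp: cosets_in_def)
  then show ?thesis
    using assms(2) lcos_m_assoc[OF K.subset] by (auto simp: cosets_in_def)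
qed

lemma act_subset_one: "\<Union>A \<subseteq> carrier G \<Longrightarrow> act_subset G \<one> A = A"
  by (simp add: act_subset_def Sup_le_iff lcos_mult_one)

lemma act_subset_mult:
  "\<Union>A \<subseteq> carrier G \<Longrightarrow> g \<in> carrier G \<Longrightarrow> h \<in> carrier G \<Longrightarrow>
    act_subset G g (act_subset G h A) = act_subset G (g \<otimes> h) A"
  by (auto simp: act_subset_def image_image lcos_m_assoc Sup_le_iff intro!: image_cong)

lemma Union_cosets_in: "subgrp_le G K H \<Longrightarrow> \<Union>(cosets_in G H K) \<subseteq> carrier G"
  by (auto simp: cosets_in_def subgrp_le_def l_coset_def dest: subgroup.mem_carrier)

lemma act_subset_cosets_in:
  assumes "subgrp_le G K H" "h \<in> H" "A \<subseteq> cosets_in G H K"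
  shows "act_subset G h A \<subseteq> cosets_in G H K"
  using l_coset_cosets_in[OF assms(1,2)] assms(3) by (auto simp: act_subset_def)

lemma stab_subgroup:
  assumes "subgroup H G" "\<Union>A \<subseteq> carrier G"
  shows "subgroup (stab G H A) G"
proof -
  interpret H: subgroup H G by fact
  show ?thesis
  proof (rule subgroupI)
    have "\<one> \<in> stab G H A" using act_subset_one[OF assms(2)] by (simp add: stab_def)
    then show "stab G H A \<noteq> {}" by blast
  next
    fix a assume a: "a \<in> stab G H A"
    then have aH: "a \<in> H" and aA: "act_subset G a A = A" by (simp_all add: stab_def)
    have "act_subset G (inv a) (act_subset G a A) = A"
      using act_subset_mult[OF assms(2), of "inv a" a] act_subset_one[OF assms(2)] aH by simp
    then show "inv a \<in> stab G H A" using aH unfolding aA by (simp add: stab_def)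
  next
    fix a b assume "a \<in> stab G H A" "b \<in> stab G H A"
    then show "a \<otimes> b \<in> stab G H A"
      using act_subset_mult[OF assms(2), of a b] by (simp add: stab_def)
  qed (auto simp: stab_def)
qed

lemma subset_orbits_some:
  assumes le: "subgrp_le G K H" and "\<Omega> \<in> subset_orbits G H K"
  shows "(SOME A. A \<in> \<Omega>) \<in> \<Omega>" "A \<in> \<Omega> \<Longrightarrow> A \<subseteq> cosets_in G H K"
    "A \<in> \<Omega> \<Longrightarrow> subgrp_le G (stab G H A) H"
proof -
  interpret H: subgroup H G using subgrp_leD[OF le] by simp
  from assms(2) obtain A0 where A0: "A0 \<subseteq> cosets_in G H K" "\<Omega> = (\<lambda>h. act_subset G h A0) ` H"
    by (auto simp: subset_orbits_def)
  then have "\<exists>A. A \<in> \<Omega>" using H.one_closed by blast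
  then show "(SOME A. A \<in> \<Omega>) \<in> \<Omega>" by (rule someI_ex)
  show *: "A \<subseteq> cosets_in G H K" if "A \<in> \<Omega>" for A
    using that A0 act_subset_cosets_in[OF le _ A0(1)] by auto
  show "subgrp_le G (stab G H A) H" if "A \<in> \<Omega>"
    using *[OF that] Union_cosets_in[OF le] stab_subgroup[OF H.subgroup_axioms, of A]
    by (auto simp: subgrp_le_def stab_def H.subgroup_axioms)
qed

lemma point_orbits_some:
  assumes le: "subgrp_le G K H" "subgrp_le G L H" and "Orb \<in> point_orbits G H L K"
  shows "(SOME h. h \<in> H \<and> h <# K \<in> Orb) \<in> H"
proof -
  from assms(3) obtain C where C: "C \<in> cosets_in G H K" "Orb = (\<lambda>l. l <# C) ` L"
    by (auto simp: point_orbits_def)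
  then obtain k where k: "k \<in> H" "C = k <# K" by (auto simp: cosets_in_def)
  have "C \<subseteq> carrier G" using C(1) Union_cosets_in[OF le(1)] by blast
  then have "C \<in> Orb" using C(2) lcos_mult_one subgroup.one_closed[OF subgrp_leD(1)[OF le(2)]]
    by (metis image_eqI)
  then have "\<exists>h. h \<in> H \<and> h <# K \<in> Orb" using k by blast
  then show ?thesis by (rule someI2_ex) simp
qed

lemma finite_point_orbits: "subgroup H G \<Longrightarrow> finite (point_orbits G H L K)"
  by (auto simp: point_orbits_def cosets_in_def subgroup_finite)

lemma point_orbits_nonempty: "subgroup H G \<Longrightarrow> point_orbits G H L K \<noteq> {}"
  using subgroup.one_closed by (fastforce simp: point_orbits_def cosets_in_def)

lemma finite_subset_orbits: "subgroup H G \<Longrightarrow> finite (subset_orbits G H K)"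
  by (auto simp: subset_orbits_def cosets_in_def subgroup_finite)

lemma recip_factor_mem:
  assumes I: "tambara_ideal G T I" "tambara_ideal G T J" and le: "subgrp_le G K H"
    and \<Omega>: "\<Omega> \<in> subset_orbits G H K" and A: "A \<in> \<Omega>"
    and Orb: "Orb \<in> point_orbits G H (stab G H A) K" and ab: "a \<in> I K" "b \<in> J K"
  shows "recip_factor H K A a b Orb \<in> I (stab G H A) \<union> J (stab G H A)"
proof -
  let ?L = "stab G H A" and ?h = "SOME h. h \<in> H \<and> h <# K \<in> Orb"
  note leL = subset_orbits_some(3)[OF le \<Omega> A]
  have h: "?h \<in> carrier G"
    using point_orbits_some[OF le leL Orb] subgroup.subset[OF subgrp_leD(2)[OF le]] by blast
  note sub = conjset_subgroup[OF h subgrp_leD(1)[OF le]]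
  note le1 = subgrp_le_Int(1)[OF subgrp_leD(1)[OF leL] sub] and le2 = subgrp_le_Int(2)[OF subgrp_leD(1)[OF leL] sub]
  have "nm T ?L (?L \<inter> conjset G ?h K) (res T (conjset G ?h K) (?L \<inter> conjset G ?h K) (cj T ?h K c)) \<in> M ?L"
    if "tambara_ideal G T M" "c \<in> M K" for M c
    by (rule ideal_nm[OF that(1) le1], rule ideal_res[OF that(1) le2], rule ideal_cj[OF that(1) h that(2)])
  then show ?thesis using I ab by (auto simp: recip_factor_def Let_def)
qed

text \<open>Every factor comes from \<open>a\<close> or from \<open>b\<close> by maps that preserve
  ideals. There is at least one orbit, and one factor in an ideal draws the whole product, and with
  it the transfer, into that ideal.\<close>

lemma recip_summand_mem:
  assumes I: "tambara_ideal G T I" "tambara_ideal G T J" and le: "subgrp_le G K H"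
    and \<Omega>: "\<Omega> \<in> subset_orbits G H K" and ab: "a \<in> I K" "b \<in> J K"
  shows "recip_summand H K a b \<Omega> \<in> I H \<union> J H"
proof -
  define A where "A = (SOME A. A \<in> \<Omega>)"
  let ?L = "stab G H A" and ?f = "recip_factor H K A a b"
  have A: "A \<in> \<Omega>" unfolding A_def using subset_orbits_some(1)[OF le \<Omega>] .
  note leL = subset_orbits_some(3)[OF le \<Omega> A]
  interpret L: cring "lev T ?L" using lev_cring subgrp_leD[OF leL] by simp
  note mem = recip_factor_mem[OF I le \<Omega> A _ ab]
  have fin: "finite (point_orbits G H ?L K)" using finite_point_orbits subgrp_leD[OF le] by simp
  obtain Orb where Orb: "Orb \<in> point_orbits G H ?L K" using point_orbits_nonempty subgrp_leD[OF le] by blast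
  have clo: "?f \<in> point_orbits G H ?L K \<rightarrow> carrier (lev T ?L)"
    using mem ideal_carrier[OF I(1)] ideal_carrier[OF I(2)] by blast
  have "finprod (lev T ?L) ?f (point_orbits G H ?L K) \<in> I ?L \<union> J ?L"
    using mem[OF Orb] L.finprod_in_ideal[OF level_ideal[OF I(1) subgrp_leD(1)[OF leL]] fin Orb _ clo]
      L.finprod_in_ideal[OF level_ideal[OF I(2) subgrp_leD(1)[OF leL]] fin Orb _ clo] by blast
  then show ?thesis
    unfolding recip_summand_def Let_def A_def[symmetric]
    using ideal_tr[OF I(1) leL] ideal_tr[OF I(2) leL] by blast
qed

lemma tr_zero:
  assumes "subgrp_le G K H"
  shows "tr T H K \<zero>\<^bsub>lev T K\<^esub> = \<zero>\<^bsub>lev T H\<^esub>"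
proof -
  interpret H: cring "lev T H" using lev_cring subgrp_leD[OF assms] by simp
  interpret K: cring "lev T K" using lev_cring subgrp_leD[OF assms] by simp
  show ?thesis
    using tr_add[OF assms K.zero_closed K.zero_closed] tr_closed[OF assms K.zero_closed]
    by (simp add: H.add.r_cancel_one')
qed

text \<open>\<open>H\<close> permutes the cosets of \<open>K\<close> transitively, so there is a
  single orbit and a single factor. That factor is a conjugate of N(0) by an element of
  \<open>H\<close>, and such conjugations act trivially at level \<open>H\<close>.\<close>

lemma recip_summand_fixed:
  assumes le: "subgrp_le G K H" and A: "stab G H A = H"
  shows "recip_summand H K \<zero>\<^bsub>lev T K\<^esub> \<zero>\<^bsub>lev T K\<^esub> {A} = nm T H K \<zero>\<^bsub>lev T K\<^esub>"
proof -
  let ?z = "\<zero>\<^bsub>lev T K\<^esub>"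
  note H = subgrp_leD(2)[OF le] and K = subgrp_leD(1)[OF le]
  interpret H: subgroup H G by (rule H)
  interpret TH: cring "lev T H" using lev_cring[OF H] .
  interpret TK: cring "lev T K" using lev_cring[OF K] .
  have orb: "(\<lambda>l. l <# C) ` H = cosets_in G H K" if C: "C \<in> cosets_in G H K" for C
  proof
    show "(\<lambda>l. l <# C) ` H \<subseteq> cosets_in G H K" using l_coset_cosets_in[OF le _ C] by blast
    obtain k where k: "k \<in> H" "C = k <# K" using C by (auto simp: cosets_in_def)
    have "h <# K = (h \<otimes> inv k) <# C" if "h \<in> H" for h
      using that k by (simp add: lcos_m_assoc[OF subgroup.subset[OF K]] m_assoc)
    then show "cosets_in G H K \<subseteq> (\<lambda>l. l <# C) ` H"
      using k(1) by (auto simp: cosets_in_def)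
  qed
  have "\<one> <# K \<in> cosets_in G H K" using H.one_closed unfolding cosets_in_def by blast
  then have "cosets_in G H K \<noteq> {}" by blast
  then have po: "point_orbits G H H K = {cosets_in G H K}"
    unfolding point_orbits_def using orb by blast
  let ?h = "SOME h. h \<in> H \<and> h <# K \<in> cosets_in G H K"
  have h: "?h \<in> H" using point_orbits_some[OF le subgrp_le_refl[OF H]] po by blast
  then have hc: "?h \<in> carrier G" by simp
  have Kh: "subgroup (conjset G ?h K) G" using conjset_subgroup[OF hc K] .
  have Hh: "conjset G ?h H = H" using conjset_self[OF H h] .
  have "conjset G ?h K \<subseteq> H" using conjset_mono[OF subgrp_leD(3)[OF le]] Hh by blast
  then have Int: "H \<inter> conjset G ?h K = conjset G ?h K" by blast
  have "recip_factor H K A ?z ?z (cosets_in G H K) = nm T H (conjset G ?h K) (cj T ?h K ?z)"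
    using A Int res_id[OF Kh] cj_closed[OF hc K] by (simp add: recip_factor_def Let_def)
  also have "\<dots> = cj T ?h H (nm T H K ?z)" using cj_nm[OF hc le] Hh by simp
  also have "\<dots> = nm T H K ?z" using cj_self[OF H h] nm_closed[OF le] by simp
  finally have *: "recip_factor H K A ?z ?z (cosets_in G H K) = nm T H K ?z" .
  show ?thesis
    using A po * tr_id[OF H] nm_closed[OF le] by (simp add: recip_summand_def Let_def)
qed

text \<open>In the reciprocity formula for N(0 + 0), the summands of the subsets with proper
  stabiliser vanish by induction, and the empty and the full subset contribute N(0) each.\<close>

lemma nm_zero:
  assumes "subgrp_le G K H"
  shows "nm T H K \<zero>\<^bsub>lev T K\<^esub> = \<zero>\<^bsub>lev T H\<^esub>"
  using assms
proof (induction H arbitrary: K rule: measure_induct_rule[of card])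
  case (less H)
  note le = less.prems
  note H = subgrp_leD(2)[OF le] and K = subgrp_leD(1)[OF le]
  interpret H: subgroup H G by (rule H)
  interpret TH: cring "lev T H" using lev_cring[OF H] .
  interpret TK: cring "lev T K" using lev_cring[OF K] .
  let ?z = "\<zero>\<^bsub>lev T K\<^esub>" and ?s = "recip_summand H K \<zero>\<^bsub>lev T K\<^esub> \<zero>\<^bsub>lev T K\<^esub>"
  let ?C = "cosets_in G H K"
  have C: "stab G H ?C = H" "stab G H {} = H"
  proof -
    have sub: "act_subset G h ?C \<subseteq> ?C" if "h \<in> H" for h using act_subset_cosets_in[OF le that] by simp
    have "act_subset G h ?C = ?C" if h: "h \<in> H" for h
    proof
      have "?C = act_subset G h (act_subset G (inv h) ?C)"
        using act_subset_mult[OF Union_cosets_in[OF le]] act_subset_one[OF Union_cosets_in[OF le]] h by simp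
      also have "\<dots> \<subseteq> act_subset G h ?C"
        using sub[of "inv h"] h by (auto simp: act_subset_def)
      finally show "?C \<subseteq> act_subset G h ?C" .
    qed (rule sub[OF h])
    then show "stab G H ?C = H" "stab G H {} = H" by (auto simp: stab_def act_subset_def)
  qed
  have orbit: "{A} \<in> subset_orbits G H K" if "A \<subseteq> ?C" "stab G H A = H" for A
  proof -
    have "act_subset G h A = A" if "h \<in> H" for h using \<open>stab G H A = H\<close> that by (auto simp: stab_def)
    then have "(\<lambda>h. act_subset G h A) ` H = {A}" using H.one_closed by blast
    then show ?thesis using that(1) unfolding subset_orbits_def by blast
  qed
  have zero: "?s \<Omega> = \<zero>\<^bsub>lev T H\<^esub>" if \<Omega>: "\<Omega> \<in> subset_orbits G H K" "\<Omega> \<notin> {{{}}, {?C}}" for \<Omega>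
  proof -
    define A where "A = (SOME A. A \<in> \<Omega>)"
    let ?L = "stab G H A" and ?f = "recip_factor H K A ?z ?z"
    have A: "A \<in> \<Omega>" unfolding A_def using subset_orbits_some(1)[OF le \<Omega>(1)] .
    note leL = subset_orbits_some(3)[OF le \<Omega>(1) A] and sub = subset_orbits_some(2)[OF le \<Omega>(1) A]
    interpret L: cring "lev T ?L" using lev_cring subgrp_leD[OF leL] by simp
    \<comment> \<open>By transitivity a subset fixed by all of \<open>H\<close> is empty or
      everything, and its orbit is then one of the two excluded singletons.\<close>
    have "?L \<noteq> H"
    proof
      assume "?L = H"
      then have fixed: "act_subset G h A = A" if "h \<in> H" for h using that by (auto simp: stab_def)
      obtain A0 where A0: "A0 \<subseteq> ?C" "\<Omega> = (\<lambda>h. act_subset G h A0) ` H"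
        using \<Omega>(1) by (auto simp: subset_orbits_def)
      then obtain h where h: "h \<in> H" "A = act_subset G h A0" using A by blast
      have hc: "h \<in> carrier G" using h(1) by simp
      have U: "\<Union>A0 \<subseteq> carrier G" using A0(1) Union_cosets_in[OF le] by blast
      have "A0 = act_subset G (inv h) A"
        using h(2) act_subset_mult[OF U inv_closed[OF hc] hc] act_subset_one[OF U] hc by simp
      also have "\<dots> = A" using fixed h(1) by simp
      finally have "\<Omega> = {A}" using A0(2) fixed H.one_closed by blast
      moreover have "A = {} \<or> A = ?C"
      proof (rule disjCI)
        assume "A \<noteq> ?C"
        then obtain h where h: "h \<in> H" "h <# K \<notin> A" using sub by (auto simp: cosets_in_def)
        have False if C: "X \<in> A" for X
        proof -
          obtain k where k: "k \<in> H" "X = k <# K" using C sub by (auto simp: cosets_in_def)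
          \<comment> \<open>The element \<open>h \<otimes> inv k\<close> moves the coset of
            \<open>k\<close>, which is in \<open>A\<close>, to the coset of \<open>h\<close>, which
            was chosen outside \<open>A\<close>.\<close>
          have "(h \<otimes> inv k) <# X \<in> act_subset G (h \<otimes> inv k) A" using C by (auto simp: act_subset_def)
          also have "\<dots> = A" using fixed h(1) k(1) by simp
          finally show False
            using h k by (simp add: lcos_m_assoc[OF subgroup.subset[OF K]] m_assoc)
        qed
        then show "A = {}" by blast
      qed
      ultimately show False using \<Omega>(2) by blast
    qed
    then have "?L \<subset> H" using subgrp_leD(3)[OF leL] by blast
    then have card: "card ?L < card H" using psubset_card_mono[OF subgroup_finite[OF H]] by blast
    have f0: "?f Orb = \<zero>\<^bsub>lev T ?L\<^esub>" if Orb: "Orb \<in> point_orbits G H ?L K" for Orb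
    proof -
      let ?h = "SOME h. h \<in> H \<and> h <# K \<in> Orb"
      have h: "?h \<in> carrier G" using point_orbits_some[OF le leL Orb] by simp
      note sub = conjset_subgroup[OF h K]
      note le1 = subgrp_le_Int(1)[OF subgrp_leD(1)[OF leL] sub] and le2 = subgrp_le_Int(2)[OF subgrp_leD(1)[OF leL] sub]
      have "cj T ?h K ?z = \<zero>\<^bsub>lev T (conjset G ?h K)\<^esub>"
        by (rule ring_hom_zero[OF cj_hom[OF h K] TK.ring_axioms lev_ring[OF sub]])
      moreover have "res T (conjset G ?h K) (?L \<inter> conjset G ?h K) \<zero>\<^bsub>lev T (conjset G ?h K)\<^esub>
          = \<zero>\<^bsub>lev T (?L \<inter> conjset G ?h K)\<^esub>"
        by (rule ring_hom_zero[OF res_hom[OF le2] lev_ring[OF sub] lev_ring[OF subgrp_leD(1)[OF le1]]])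
      ultimately show ?thesis
        using less.IH[OF card le1] by (simp add: recip_factor_def Let_def)
    qed
    obtain Orb where Orb: "Orb \<in> point_orbits G H ?L K" using point_orbits_nonempty[OF H] by blast
    have "finprod (lev T ?L) ?f (point_orbits G H ?L K) \<in> {\<zero>\<^bsub>lev T ?L\<^esub>}"
      by (rule L.finprod_in_ideal[OF L.zeroideal finite_point_orbits[OF H] Orb]) (use f0 Orb in auto)
    then show ?thesis
      unfolding recip_summand_def Let_def A_def[symmetric] using tr_zero[OF leL] by simp
  qed
  let ?n = "nm T H K ?z"
  have n: "?n \<in> carrier (lev T H)" using nm_closed[OF le] by simp
  have "\<one> <# K \<in> ?C" using H.one_closed unfolding cosets_in_def by blast
  \<comment> \<open>The two orbits must be distinct, or N(0) would be counted once and nothing could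
    be cancelled.\<close>
  then have ne: "{{}} \<noteq> {?C}" by blast
  have s: "?s {{}} = ?n" "?s {?C} = ?n" using recip_summand_fixed[OF le] C by auto
  have car: "?s \<Omega> \<in> carrier (lev T H)" if "\<Omega> \<in> subset_orbits G H K" for \<Omega>
    using zero[OF that] s n by (cases "\<Omega> \<in> {{{}}, {?C}}") auto
  have "?n = nm T H K (?z \<oplus>\<^bsub>lev T K\<^esub> ?z)" by simp
  also have "\<dots> = finsum (lev T H) ?s (subset_orbits G H K)"
    using tambara_reciprocity[OF le TK.zero_closed TK.zero_closed] unfolding recip_rhs .
  also have "\<dots> = finsum (lev T H) ?s {{{}}, {?C}}"
    using orbit[of "{}"] orbit[of ?C] C zero car
    by (intro TH.add.finprod_mono_neutral_cong_right finite_subset_orbits[OF H]) auto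
  also have "\<dots> = ?n \<oplus>\<^bsub>lev T H\<^esub> ?n"
    using TH.finsum_insert[of "{{?C}}" "{{}}" ?s] ne n s by simp
  finally show ?case using n TH.add.r_cancel_one' by metis
qed

text \<open>Closure under norms is \<open>nm_zero\<close>. This family makes the union in
  \<open>ideal_sum\<close> nonempty even when no ideals are summed.\<close>

lemma zero_ideal: "tambara_ideal G T (\<lambda>H. if subgroup H G then {\<zero>\<^bsub>lev T H\<^esub>} else {})"
proof (rule tambara_idealI)
  fix H K x assume le: "subgrp_le G K H" and x: "x \<in> (if subgroup H G then {\<zero>\<^bsub>lev T H\<^esub>} else {})"
  show "res T H K x \<in> (if subgroup K G then {\<zero>\<^bsub>lev T K\<^esub>} else {})"
    using x subgrp_leD[OF le] ring_hom_zero[OF res_hom[OF le] lev_ring lev_ring] by simp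
next
  fix g H x assume g: "g \<in> carrier G" and x: "x \<in> (if subgroup H G then {\<zero>\<^bsub>lev T H\<^esub>} else {})"
  then have H: "subgroup H G" by (simp split: if_splits)
  show "cj T g H x \<in> (if subgroup (conjset G g H) G then {\<zero>\<^bsub>lev T (conjset G g H)\<^esub>} else {})"
    using x H conjset_subgroup[OF g H] ring_hom_zero[OF cj_hom[OF g H] lev_ring lev_ring] by simp
qed (auto simp: ring.zeroideal[OF lev_ring] tr_zero nm_zero subgrp_leD split: if_splits)

text \<open>Closure under norms is the point: reciprocity expands N(a + b) into summands each of
  which lies in one of the two ideals.\<close>

lemma sum_ideal:
  assumes I: "tambara_ideal G T I" and J: "tambara_ideal G T J"
  shows "tambara_ideal G T (\<lambda>H. I H <+>\<^bsub>lev T H\<^esub> J H)" (is "tambara_ideal G T ?S")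
proof -
  have S: "\<exists>a\<in>I H. \<exists>b\<in>J H. x = a \<oplus>\<^bsub>lev T H\<^esub> b" if "x \<in> ?S H" for x H
    using that by (auto simp: set_add_def' )
  have SI: "a \<oplus>\<^bsub>lev T H\<^esub> b \<in> ?S H" if "a \<in> I H" "b \<in> J H" for a b H
    using that by (auto simp: set_add_def')
  have ideal: "ideal (?S H) (lev T H)" if "subgroup H G" for H
    using ring.add_ideals[OF lev_ring[OF that] level_ideal[OF I that] level_ideal[OF J that]] .
  show ?thesis
  proof (rule tambara_idealI)
    fix H x assume "x \<in> ?S H"
    then show "subgroup H G" using S ideal_subgroup[OF I] by blast
  next
    fix H K x assume le: "subgrp_le G K H" and "x \<in> ?S H"
    then obtain a b where ab: "a \<in> I H" "b \<in> J H" "x = a \<oplus>\<^bsub>lev T H\<^esub> b" using S by blast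
    then show "res T H K x \<in> ?S K"
      using SI[OF ideal_res[OF I le ab(1)] ideal_res[OF J le ab(2)]]
        ring_hom_add[OF res_hom[OF le] ideal_carrier[OF I ab(1)] ideal_carrier[OF J ab(2)]] by simp
  next
    fix g H x assume g: "g \<in> carrier G" and "x \<in> ?S H"
    then obtain a b where ab: "a \<in> I H" "b \<in> J H" "x = a \<oplus>\<^bsub>lev T H\<^esub> b" using S by blast
    then show "cj T g H x \<in> ?S (conjset G g H)"
      using SI[OF ideal_cj[OF I g ab(1)] ideal_cj[OF J g ab(2)]]
        ring_hom_add[OF cj_hom[OF g ideal_subgroup[OF I ab(1)]] ideal_carrier[OF I ab(1)] ideal_carrier[OF J ab(2)]]
      by simp
  next
    fix H K x assume le: "subgrp_le G K H" and "x \<in> ?S K"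
    then obtain a b where ab: "a \<in> I K" "b \<in> J K" "x = a \<oplus>\<^bsub>lev T K\<^esub> b" using S by blast
    note car = ideal_carrier[OF I ab(1)] ideal_carrier[OF J ab(2)]
    show "tr T H K x \<in> ?S H"
      using SI[OF ideal_tr[OF I le ab(1)] ideal_tr[OF J le ab(2)]] tr_add[OF le car] ab(3) by simp
    interpret H: cring "lev T H" using lev_cring subgrp_leD[OF le] by simp
    have zero: "\<zero>\<^bsub>lev T H\<^esub> \<in> I H" "\<zero>\<^bsub>lev T H\<^esub> \<in> J H"
      using additive_subgroup.zero_closed[OF ideal.axioms(1)] level_ideal[OF I] level_ideal[OF J] subgrp_leD[OF le]
      by blast+
    have "I H \<union> J H \<subseteq> ?S H"
    proof
      fix y assume "y \<in> I H \<union> J H"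
      then show "y \<in> ?S H"
        using SI[of y H "\<zero>\<^bsub>lev T H\<^esub>"] SI[of "\<zero>\<^bsub>lev T H\<^esub>" H y] zero ideal_carrier[OF I, of y H]
          ideal_carrier[OF J, of y H] by auto
    qed
    then have "finsum (lev T H) (recip_summand H K a b) (subset_orbits G H K) \<in> ?S H"
      using recip_summand_mem[OF I J le _ ab(1,2)]
      by (intro H.finsum_in_ideal[OF ideal[OF subgrp_leD(2)[OF le]]]) blast
    then show "nm T H K x \<in> ?S H"
      using tambara_reciprocity[OF le car] recip_rhs ab(3) by simp
  qed (rule ideal)
qed

lemma ideal_sum_nonsub: "x \<in> ideal_sum G T F H \<Longrightarrow> subgroup H G"
  by (auto simp: ideal_sum_def split: if_splits)

lemma le_ideal_sum:
  assumes "\<And>I. I \<in> F \<Longrightarrow> tambara_ideal G T I" "I \<in> F"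
  shows "I \<le> ideal_sum G T F"
proof (rule le_funI, rule subsetI)
  fix H x assume x: "x \<in> I H"
  interpret H: cring "lev T H" using lev_cring ideal_subgroup[OF assms(1)[OF assms(2)] x] by simp
  have "(\<Union>I\<in>F. I H) \<subseteq> carrier (lev T H)" using assms(1) ideal_carrier by blast
  then have "(\<Union>I\<in>F. I H) \<subseteq> genideal (lev T H) (\<Union>I\<in>F. I H)" by (rule H.genideal_self)
  then show "x \<in> ideal_sum G T F H"
    using x assms ideal_subgroup[OF assms(1)[OF assms(2)] x] by (auto simp: ideal_sum_def)
qed

lemma ideal_sum_least:
  assumes "tambara_ideal G T P" "\<And>I. I \<in> F \<Longrightarrow> I \<le> P"
  shows "ideal_sum G T F \<le> P"
proof (rule le_funI)
  fix H
  have "(\<Union>I\<in>F. I H) \<subseteq> P H" using assms(2) by (auto simp: le_fun_def)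
  then show "ideal_sum G T F H \<subseteq> P H"
    using ring.genideal_minimal[OF lev_ring level_ideal[OF assms(1)]] by (simp add: ideal_sum_def)
qed

text \<open>Every element of the levelwise sum lies in a Tambara ideal below it, because finite sums
  of Tambara ideals are Tambara ideals.\<close>

lemma ideal_sum:
  assumes F: "\<And>I. I \<in> F \<Longrightarrow> tambara_ideal G T I"
  shows "tambara_ideal G T (ideal_sum G T F)"
proof -
  let ?S = "ideal_sum G T F"
  have idealS: "ideal (?S H) (lev T H)" if H: "subgroup H G" for H
  proof -
    have "(\<Union>I\<in>F. I H) \<subseteq> carrier (lev T H)" using F ideal_carrier by blast
    then show ?thesis using ring.genideal_ideal[OF lev_ring[OF H]] H by (simp add: ideal_sum_def)
  qed
  \<comment> \<open>By \<open>sum_ideal\<close> this family is directed, so at each level its union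
    is a ring ideal, and it contains every member of \<open>F\<close>. An element of the sum thus
    lies in a single member of \<open>D\<close>, whose closure under norms can be used.\<close>
  define D where "D = {J. tambara_ideal G T J \<and> J \<le> ?S}"
  have D: "\<exists>J\<in>D. x \<in> J H" if x: "x \<in> ?S H" for x H
  proof -
    have H: "subgroup H G" using ideal_sum_nonsub[OF x] .
    interpret H: cring "lev T H" using lev_cring[OF H] .
    let ?U = "\<Union>J\<in>D. J H"
    have Did: "ideal (J H) (lev T H)" if "J \<in> D" for J
      using that level_ideal[OF _ H] by (simp add: D_def)
    have "ideal ?U (lev T H)"
    proof (rule idealI)
      show "ring (lev T H)" by (rule H.ring_axioms)
      show "subgroup ?U (add_monoid (lev T H))"
      proof (rule group.subgroupI)
        show "Group.group (add_monoid (lev T H))" by (rule H.a_group)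
        show "?U \<subseteq> carrier (add_monoid (lev T H))"
          using ideal_carrier by (auto simp: D_def)
        have "\<zero>\<^bsub>lev T K\<^esub> \<in> ?S K" if "subgroup K G" for K
          using additive_subgroup.zero_closed[OF ideal.axioms(1)[OF idealS[OF that]]] .
        then have "(\<lambda>H. if subgroup H G then {\<zero>\<^bsub>lev T H\<^esub>} else {}) \<in> D"
          using zero_ideal by (auto simp: D_def le_fun_def)
        then show "?U \<noteq> {}" using H by force
      next
        fix a assume "a \<in> ?U"
        then obtain J where "J \<in> D" "a \<in> J H" by blast
        then show "inv\<^bsub>add_monoid (lev T H)\<^esub> a \<in> ?U"
          using additive_subgroup.a_inv_closed[OF ideal.axioms(1)[OF Did]]
          unfolding a_inv_def[symmetric] by blast
      next
        fix a b assume "a \<in> ?U" "b \<in> ?U"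
        then obtain I J where IJ: "I \<in> D" "a \<in> I H" "J \<in> D" "b \<in> J H" by blast
        have "(\<lambda>K. I K <+>\<^bsub>lev T K\<^esub> J K) \<le> ?S"
        proof (rule le_funI, rule subsetI)
          fix K y assume "y \<in> I K <+>\<^bsub>lev T K\<^esub> J K"
          then obtain u v where y: "u \<in> I K" "v \<in> J K" "y = u \<oplus>\<^bsub>lev T K\<^esub> v" by (auto simp: set_add_def')
          then have "u \<in> ?S K" "v \<in> ?S K" using IJ by (auto simp: D_def le_fun_def)
          then show "y \<in> ?S K"
            using additive_subgroup.a_closed[OF ideal.axioms(1)[OF idealS]] ideal_sum_nonsub y(3) by blast
        qed
        then have "(\<lambda>K. I K <+>\<^bsub>lev T K\<^esub> J K) \<in> D" using IJ sum_ideal by (simp add: D_def)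
        moreover have "a \<oplus>\<^bsub>lev T H\<^esub> b \<in> I H <+>\<^bsub>lev T H\<^esub> J H" using IJ by (auto simp: set_add_def')
        ultimately show "a \<otimes>\<^bsub>add_monoid (lev T H)\<^esub> b \<in> ?U" by auto
      qed
    next
      fix a r assume "a \<in> ?U" and r: "r \<in> carrier (lev T H)"
      then obtain J where J: "J \<in> D" "a \<in> J H" by blast
      have "r \<otimes>\<^bsub>lev T H\<^esub> a \<in> J H" "a \<otimes>\<^bsub>lev T H\<^esub> r \<in> J H"
        by (rule ideal.I_l_closed[OF Did[OF J(1)] J(2) r], rule ideal.I_r_closed[OF Did[OF J(1)] J(2) r])
      with J(1) show "r \<otimes>\<^bsub>lev T H\<^esub> a \<in> ?U" "a \<otimes>\<^bsub>lev T H\<^esub> r \<in> ?U" by blast+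
    qed
    moreover have "(\<Union>I\<in>F. I H) \<subseteq> ?U" using F le_ideal_sum[of F] by (auto simp: D_def)
    ultimately have "genideal (lev T H) (\<Union>I\<in>F. I H) \<subseteq> ?U" by (rule H.genideal_minimal)
    then show ?thesis using x H by (auto simp: ideal_sum_def)
  qed
  have DS: "y \<in> ?S K" if "J \<in> D" "y \<in> J K" for J y K using that by (auto simp: D_def le_fun_def)
  have DT: "tambara_ideal G T J" if "J \<in> D" for J using that by (simp add: D_def)
  show ?thesis
  proof (rule tambara_idealI)
    fix H K x assume le: "subgrp_le G K H" and "x \<in> ?S H"
    then show "res T H K x \<in> ?S K" using D DS ideal_res[OF DT le] by blast
  next
    fix H K x assume le: "subgrp_le G K H" and "x \<in> ?S K"
    then show "tr T H K x \<in> ?S H" "nm T H K x \<in> ?S H"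
      using D DS ideal_tr[OF DT le] ideal_nm[OF DT le] by blast+
  next
    fix g H x assume g: "g \<in> carrier G" and "x \<in> ?S H"
    then show "cj T g H x \<in> ?S (conjset G g H)" using D DS ideal_cj[OF DT g] by blast
  qed (auto intro: idealS ideal_sum_nonsub)
qed

section \<open>Points and primes\<close>

lemma frame_join_RadId: "F \<subseteq> RadId G T \<Longrightarrow> frame_join G T F \<in> RadId G T"
  unfolding frame_join_def using RadIdD(1) by (intro radical_RadId ideal_sum) blast

lemma le_frame_join:
  assumes "F \<subseteq> RadId G T" "I \<in> F"
  shows "I \<le> frame_join G T F"
proof -
  have F: "\<And>I. I \<in> F \<Longrightarrow> tambara_ideal G T I" using assms(1) RadIdD(1) by blast
  have "I \<le> ideal_sum G T F" by (rule le_ideal_sum[OF F assms(2)])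
  also have "\<dots> \<le> frame_join G T F" unfolding frame_join_def by (rule le_radical[OF ideal_sum[OF F]])
  finally show ?thesis .
qed

lemma frame_join_least:
  assumes "P \<in> RadId G T" "\<And>I. I \<in> F \<Longrightarrow> I \<le> P"
  shows "frame_join G T F \<le> P"
  using radical_mono[OF ideal_sum_least[OF RadIdD(1)[OF assms(1)] assms(2)]] RadIdD(2)[OF assms(1)]
  by (simp add: frame_join_def)

text \<open>Products and meets agree up to radicals: if x^n is in I and x^m is in J, then x^(n + m)
  is in IJ. This links primality, stated with products, to points, which respect
  intersections.\<close>

lemma RadId_mult_mem:
  assumes P: "P \<in> RadId G T" and IJ: "tambara_ideal G T I" "tambara_ideal G T J"
    and le: "ideal_prod G T I J \<le> P"
  shows "inf (radical G T I) (radical G T J) \<le> P"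
proof (rule le_funI, rule subsetI)
  fix H x assume "x \<in> inf (radical G T I) (radical G T J) H"
  then obtain n m :: nat where x: "subgroup H G" "x \<in> carrier (lev T H)"
    "x [^]\<^bsub>lev T H\<^esub> n \<in> I H" "x [^]\<^bsub>lev T H\<^esub> m \<in> J H"
    using radical_eq IJ by auto
  interpret cring "lev T H" using lev_cring x by simp
  have "x [^]\<^bsub>lev T H\<^esub> n \<otimes>\<^bsub>lev T H\<^esub> x [^]\<^bsub>lev T H\<^esub> m \<in> P H"
    using ideal_prod_mem[where J = J and H = H, OF IJ(1) x(3,4)] le by (auto simp: le_fun_def)
  then have "x [^]\<^bsub>lev T H\<^esub> (n + m) \<in> P H" using x(2) by (simp add: nat_pow_mult)
  then show "x \<in> P H" using P x(1,2) unfolding RadId_iff by blast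
qed

lemma prime_pow_le:
  assumes "prime_tideal G T P" "tambara_ideal G T I" "n \<ge> 1" "ideal_pow G T I n \<le> P"
  shows "I \<le> P"
  using assms(3,4)
proof (induction n rule: dec_induct)
  case base
  then show ?case by simp
next
  case (step n)
  then have "ideal_prod G T (ideal_pow G T I n) I \<le> P" by simp
  then show ?case
    using assms(1) ideal_pow[OF assms(2)] assms(2) step.IH unfolding prime_tideal_def by blast
qed

text \<open>Iterated primality, \<open>prime_pow_le\<close>, brings <x>^n below \<open>P\<close>
  down to <x> below \<open>P\<close>.\<close>

lemma prime_RadId:
  assumes "prime_tideal G T P"
  shows "P \<in> RadId G T"
proof -
  have P: "tambara_ideal G T P" using assms by (simp add: prime_tideal_def)
  have "radical G T P \<le> P"
  proof (rule le_funI, rule subsetI)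
    fix H x assume "x \<in> radical G T P H"
    then obtain n where x: "subgroup H G" "x \<in> carrier (lev T H)" "n \<ge> 1"
      "ideal_pow G T (principal H x) n \<le> P"
      by (auto simp: radical_def split: if_splits)
    have "principal H x \<le> P" by (rule prime_pow_le[OF assms principal(1)[OF x(1,2)] x(3,4)])
    then show "x \<in> P H" using principal(2)[OF x(1,2)] by (auto simp: le_fun_def)
  qed
  then show ?thesis using P le_radical[OF P] by (simp add: RadId_def)
qed

text \<open>One at the top level restricts to one at every level. Properness thereby becomes a
  statement about the top element of the frame.\<close>

lemma proper_ideal_iff:
  assumes "tambara_ideal G T P"
  shows "proper_ideal G T P \<longleftrightarrow> \<not> unit_ideal G T \<le> P"
proof -
  have "x \<in> P H" if "\<one>\<^bsub>lev T (carrier G)\<^esub> \<in> P (carrier G)" "subgroup H G" "x \<in> carrier (lev T H)" for H x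
  proof -
    have le: "subgrp_le G H (carrier G)"
      using that(2) subgroup_self subgroup.subset by (auto simp: subgrp_le_def)
    have "\<one>\<^bsub>lev T H\<^esub> \<in> P H"
      using ideal_res[OF assms le that(1)] ring_hom_one[OF res_hom[OF le]] by simp
    then show ?thesis using ideal.one_imp_carrier[OF level_ideal[OF assms that(2)]] that(3) by simp
  qed
  moreover have "\<one>\<^bsub>lev T (carrier G)\<^esub> \<in> unit_ideal G T (carrier G)"
    using ring.ring_simprules(6)[OF lev_ring[OF subgroup_self]] by (simp add: unit_ideal_def subgroup_self)
  ultimately have "\<one>\<^bsub>lev T (carrier G)\<^esub> \<in> P (carrier G) \<longleftrightarrow> unit_ideal G T \<le> P"
    by (auto simp: le_fun_def unit_ideal_def split: if_splits)
  then show ?thesis by (simp add: proper_ideal_def)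
qed

section \<open>The correspondence between points and primes\<close>

definition prime_of_point :: "(('g, 'a) fam \<Rightarrow> bool) \<Rightarrow> ('g, 'a) fam" where
  "prime_of_point p = frame_join G T {I \<in> RadId G T. \<not> p I}"

text \<open>The first conjunct follows the convention that points are false outside
  \<open>RadId\<close>, so that \<open>point_of_prime_of_point\<close> is an equality of
  functions.\<close>

definition point_of_prime :: "('g, 'a) fam \<Rightarrow> ('g, 'a) fam \<Rightarrow> bool" where
  "point_of_prime P I \<longleftrightarrow> I \<in> RadId G T \<and> \<not> I \<le> P"

lemma prime_of_point_RadId: "prime_of_point p \<in> RadId G T"
  unfolding prime_of_point_def by (rule frame_join_RadId) blast

text \<open>Preservation of joins makes \<open>p\<close> false at \<open>prime_of_point p\<close>,
  and preservation of meets makes \<open>p\<close> monotone, hence false at every radical ideal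
  below it. Conversely, any ideal at which \<open>p\<close> is false is one of those joined.\<close>

lemma point_iff:
  assumes p: "p \<in> frame_points G T" and I: "I \<in> RadId G T"
  shows "p I \<longleftrightarrow> \<not> I \<le> prime_of_point p"
proof
  let ?F = "{I \<in> RadId G T. \<not> p I}"
  have "?F \<subseteq> RadId G T" by blast
  then have np: "\<not> p (prime_of_point p)"
    using p unfolding frame_points_def prime_of_point_def by auto
  assume "p I"
  show "\<not> I \<le> prime_of_point p"
  proof
    assume "I \<le> prime_of_point p"
    then have "inf I (prime_of_point p) = I" by (simp add: inf_absorb1)
    moreover have "p (inf I (prime_of_point p)) \<longleftrightarrow> p I \<and> p (prime_of_point p)"
      using p I prime_of_point_RadId by (simp add: frame_points_def)
    ultimately show False using \<open>p I\<close> np by simp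
  qed
next
  assume "\<not> I \<le> prime_of_point p"
  then show "p I" using le_frame_join[of "{I \<in> RadId G T. \<not> p I}" I] I
    unfolding prime_of_point_def by blast
qed

text \<open>Primality quantifies over all Tambara ideals while \<open>p\<close> is governed only on
  radical ones, so both ideals are replaced by their radicals before \<open>p\<close> is applied to
  the meet.\<close>

lemma prime_of_point:
  assumes p: "p \<in> frame_points G T"
  shows "prime_of_point p \<in> SpecNak G T"
proof -
  let ?P = "prime_of_point p"
  note PR = prime_of_point_RadId[of p]
  have P: "tambara_ideal G T ?P" using RadIdD(1)[OF PR] .
  have "p (unit_ideal G T)" using p by (simp add: frame_points_def)
  then have "proper_ideal G T ?P" using proper_ideal_iff[OF P] point_iff[OF p unit_RadId] by simp
  moreover have "I \<le> ?P \<or> J \<le> ?P"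
    if IJ: "tambara_ideal G T I" "tambara_ideal G T J" "ideal_prod G T I J \<le> ?P" for I J
  proof -
    let ?I = "radical G T I" and ?J = "radical G T J"
    note R = radical_RadId[OF IJ(1)] radical_RadId[OF IJ(2)]
    have "\<not> p (inf ?I ?J)"
      using point_iff[OF p RadId_inf[OF R]] RadId_mult_mem[OF PR IJ] by simp
    moreover have "p (inf ?I ?J) \<longleftrightarrow> p ?I \<and> p ?J" using p R by (simp add: frame_points_def)
    ultimately have "?I \<le> ?P \<or> ?J \<le> ?P" using point_iff[OF p] R by blast
    then show ?thesis using le_radical[OF IJ(1)] le_radical[OF IJ(2)] order_trans by blast
  qed
  ultimately show ?thesis using P by (simp add: SpecNak_def prime_tideal_def)
qed

lemma point_of_prime:
  assumes "P \<in> SpecNak G T"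
  shows "point_of_prime P \<in> frame_points G T"
proof -
  have prime: "prime_tideal G T P" using assms by (simp add: SpecNak_def)
  note PR = prime_RadId[OF prime]
  have "\<not> unit_ideal G T \<le> P"
    using prime proper_ideal_iff[of P] unfolding prime_tideal_def by blast
  moreover have "inf I J \<le> P \<longleftrightarrow> I \<le> P \<or> J \<le> P" if "I \<in> RadId G T" "J \<in> RadId G T" for I J
  proof
    note IJ = RadIdD(1)[OF that(1)] RadIdD(1)[OF that(2)]
    assume "inf I J \<le> P"
    \<comment> \<open>The product lies below the meet, so primality, stated for products,
      applies.\<close>
    then have "ideal_prod G T I J \<le> P" using ideal_prod_le[OF IJ] by (rule order_trans[rotated])
    then show "I \<le> P \<or> J \<le> P" using prime IJ unfolding prime_tideal_def by blast
  qed (use le_infI1 le_infI2 in blast)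
  moreover have "frame_join G T F \<le> P \<longleftrightarrow> (\<forall>I\<in>F. I \<le> P)" if "F \<subseteq> RadId G T" for F
    using le_frame_join[OF that] frame_join_least[OF PR, of F] by (meson order_trans)
  ultimately show ?thesis
    unfolding frame_points_def point_of_prime_def
    using unit_RadId RadId_inf frame_join_RadId by auto
qed

lemma point_of_prime_of_point:
  assumes "p \<in> frame_points G T"
  shows "point_of_prime (prime_of_point p) = p"
proof
  fix I show "point_of_prime (prime_of_point p) I = p I"
    using point_iff[OF assms] assms unfolding point_of_prime_def frame_points_def by blast
qed

text \<open>A prime is itself radical, hence the largest radical ideal below \<open>P\<close> is
  \<open>P\<close>.\<close>

lemma prime_of_point_of_prime:
  assumes "P \<in> SpecNak G T"
  shows "prime_of_point (point_of_prime P) = P"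
proof -
  have PR: "P \<in> RadId G T" using assms prime_RadId by (simp add: SpecNak_def)
  have "{I \<in> RadId G T. \<not> point_of_prime P I} = {I \<in> RadId G T. I \<le> P}"
    by (auto simp: point_of_prime_def)
  moreover have "frame_join G T {I \<in> RadId G T. I \<le> P} = P"
    using PR by (intro antisym frame_join_least le_frame_join) auto
  ultimately show ?thesis by (simp add: prime_of_point_def)
qed

section \<open>Continuity in both directions\<close>

lemma topspace_pt: "topspace (pt_topology G T) = frame_points G T"
  by (auto simp: pt_topology_def U_open_def)

lemma topspace_spec: "topspace (spec_topology G T) = SpecNak G T"
  by (auto simp: spec_topology_def)

lemma openin_U: "I \<in> RadId G T \<Longrightarrow> openin (pt_topology G T) (U_open G T I)"
  unfolding pt_topology_def by (rule topology_generated_by_Basis) blast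

lemma openin_compl_V:
  "subgroup H G \<Longrightarrow> x \<in> carrier (lev T H) \<Longrightarrow> openin (spec_topology G T) (SpecNak G T - V_set G T H x)"
  unfolding spec_topology_def by (rule topology_generated_by_Basis) blast

text \<open>A radical ideal contains x at level \<open>H\<close> exactly if it contains the radical
  of \<open>principal H x\<close>. So the complement of \<open>V_set G T H x\<close> pulls back to
  the basic open set of that radical.\<close>

lemma continuous_prime_of_point: "continuous_map (pt_topology G T) (spec_topology G T) prime_of_point"
  unfolding spec_topology_def
proof (rule continuous_on_generated_topo)
  fix U assume "U \<in> insert (SpecNak G T)
    {SpecNak G T - V_set G T H x | H x. subgroup H G \<and> x \<in> carrier (lev T H)}"
  then consider "U = SpecNak G T" | H x where "subgroup H G" "x \<in> carrier (lev T H)"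
    "U = SpecNak G T - V_set G T H x" by blast
  then show "openin (pt_topology G T) (prime_of_point -` U \<inter> topspace (pt_topology G T))"
  proof cases
    case 1
    then have "prime_of_point -` U \<inter> topspace (pt_topology G T) = topspace (pt_topology G T)"
      using prime_of_point by (auto simp: topspace_pt)
    then show ?thesis by simp
  next
    case (2 H x)
    let ?I = "radical G T (principal H x)"
    note J = principal[OF 2(1,2)]
    have IR: "?I \<in> RadId G T" using radical_RadId[OF J(1)] .
    have "x \<in> P H \<longleftrightarrow> ?I \<le> P" if "P \<in> RadId G T" for P
    proof
      assume "x \<in> P H"
      then have "principal H x \<le> P" using principal_le[OF RadIdD(1)[OF that]] by simp
      then show "?I \<le> P" using radical_mono RadIdD(2)[OF that] by metis
    next
      assume "?I \<le> P"
      then show "x \<in> P H" using le_radical[OF J(1)] J(2) by (auto simp: le_fun_def)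
    qed
    then have "p \<in> prime_of_point -` U \<longleftrightarrow> p ?I" if "p \<in> frame_points G T" for p
      using prime_of_point[OF that] prime_of_point_RadId[of p] point_iff[OF that IR]
      by (auto simp: 2(3) V_set_def)
    then have "prime_of_point -` U \<inter> topspace (pt_topology G T) = U_open G T ?I"
      by (auto simp: topspace_pt U_open_def)
    then show ?thesis using openin_U[OF IR] by simp
  qed
next
  show "prime_of_point ` topspace (pt_topology G T) \<subseteq> \<Union> (insert (SpecNak G T)
    {SpecNak G T - V_set G T H x | H x. subgroup H G \<and> x \<in> carrier (lev T H)})"
    using prime_of_point by (auto simp: topspace_pt)
qed

text \<open>Failure of \<open>I \<le> P\<close> is witnessed by one element at one level, so the
  preimage of \<open>U_open G T I\<close> is a union of complements of sets
  \<open>V_set G T H x\<close> with x in \<open>I H\<close>.\<close>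

lemma continuous_point_of_prime: "continuous_map (spec_topology G T) (pt_topology G T) point_of_prime"
  unfolding pt_topology_def
proof (rule continuous_on_generated_topo)
  fix U assume "U \<in> insert (frame_points G T) {U_open G T I | I. I \<in> RadId G T}"
  then consider "U = frame_points G T" | I where "I \<in> RadId G T" "U = U_open G T I" by blast
  then show "openin (spec_topology G T) (point_of_prime -` U \<inter> topspace (spec_topology G T))"
  proof cases
    case 1
    then have "point_of_prime -` U \<inter> topspace (spec_topology G T) = topspace (spec_topology G T)"
      using point_of_prime by (auto simp: topspace_spec)
    then show ?thesis by simp
  next
    case (2 I)
    note I = RadIdD(1)[OF 2(1)]
    let ?\<U> = "{SpecNak G T - V_set G T H x | H x. x \<in> I H}"
    have "point_of_prime -` U \<inter> topspace (spec_topology G T) = {P \<in> SpecNak G T. \<not> I \<le> P}"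
      using point_of_prime 2 by (auto simp: topspace_spec U_open_def point_of_prime_def)
    also have "\<dots> = \<Union> ?\<U>"
    proof -
      have "\<not> I \<le> P \<longleftrightarrow> (\<exists>H x. x \<in> I H \<and> x \<notin> P H)" for P by (auto simp: le_fun_def)
      then show ?thesis unfolding V_set_def by blast
    qed
    finally show ?thesis
      using openin_compl_V ideal_subgroup[OF I] ideal_carrier[OF I] by (auto intro!: openin_Union)
  qed
next
  show "point_of_prime ` topspace (spec_topology G T)
    \<subseteq> \<Union> (insert (frame_points G T) {U_open G T I | I. I \<in> RadId G T})"
    using point_of_prime by (auto simp: topspace_spec)
qed

lemma homeomorphic_prime_of_point:
  "homeomorphic_map (pt_topology G T) (spec_topology G T) prime_of_point"
proof -
  have "homeomorphic_maps (pt_topology G T) (spec_topology G T) prime_of_point point_of_prime"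
    unfolding homeomorphic_maps_def topspace_pt topspace_spec
    using continuous_prime_of_point continuous_point_of_prime
      point_of_prime_of_point prime_of_point_of_prime by blast
  then show ?thesis by (rule homeomorphic_maps_imp_map)
qed

lemma prime_of_point_image:
  assumes I: "I \<in> RadId G T"
  shows "prime_of_point ` U_open G T I = {P \<in> SpecNak G T. \<not> I \<le> P}"
proof
  show "prime_of_point ` U_open G T I \<subseteq> {P \<in> SpecNak G T. \<not> I \<le> P}"
    using prime_of_point point_iff[OF _ I] by (auto simp: U_open_def)
  show "{P \<in> SpecNak G T. \<not> I \<le> P} \<subseteq> prime_of_point ` U_open G T I"
  proof
    fix P assume P: "P \<in> {P \<in> SpecNak G T. \<not> I \<le> P}"
    then have "point_of_prime P \<in> U_open G T I"
      using point_of_prime I by (simp add: U_open_def point_of_prime_def[of P I])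
    then show "P \<in> prime_of_point ` U_open G T I"
      using P prime_of_point_of_prime by (metis (mono_tags, lifting) image_eqI mem_Collect_eq)
  qed
qed

end

theorem theorem5p4:
  fixes G :: "('g, 'b) monoid_scheme" and T :: "('g, 'a, 'c) tambara_data_scheme"
  assumes "group G" and "finite (carrier G)" and "tambara_functor G T"
  shows "\<exists>\<phi>. homeomorphic_map (pt_topology G T) (spec_topology G T) \<phi> \<and>
           (\<forall>I\<in>RadId G T. \<phi> ` U_open G T I = {P \<in> SpecNak G T. \<not> I \<le> P})"
proof -
  interpret tambara G T
    using assms by (simp add: tambara_def tambara_axioms_def)
  show ?thesis
    using homeomorphic_prime_of_point prime_of_point_image by blast
qed

end
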